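(* Let $T>0$, let $\mathbb{U}\subset\mathbb{R}^m$ be compact and non-empty, and let $f:[0,T]\times\mathbb{R}^n\times\mathbb{U}\to\mathbb{R}^n$ be continuous and Lipschitz continuous in $x$ uniformly in $(s,u)$. Let $g\in C(\mathbb{R}^n;\mathbb{R})$ and $\mathcal{X}=\{x\in\mathbb{R}^n\,|\,g(x)\le 0\}$. Let $\underline{v}\in C([0,T]\times\mathbb{R}^n;\mathbb{R})$ be a viscosity subsolution of $-v_t+H(t,x,\nabla v)=0$ on $\Omega=\{(t,x)\in(0,T)\times\mathbb{R}^n\,|\,\underline{v}(t,x)>0\}$, with $\underline{v}(T,x)=\underline{g}(x)$ for all $x\in\mathbb{R}^n$. If $\underline{g}(x)\le 0$ for all $x\in\mathcal{X}$, then for every $t\in[0,T]$, $$\mathcal{G}(t)\subseteq\overline{\mathcal{G}}(t):=\{x\in\mathbb{R}^n\,|\,\underline{v}(t,x)\le 0\}.$$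
   Context: For $t\in[0,T]$, $\mathcal{U}[t,T]$ is the set of measurable maps $u:[t,T]\to\mathbb{U}$. For $x\in\mathbb{R}^n$ and $u\in\mathcal{U}[t,T]$, $\varphi(\cdot;t,x,u)$ denotes the unique (absolutely continuous) solution of $\dot{x}(s)=f(s,x(s),u(s))$ for a.e. $s\in(t,T)$, $x(t)=x$. The backwards reachable set is $\mathcal{G}(t)=\{x\in\mathbb{R}^n\,|\,\exists u\in\mathcal{U}[t,T]\text{ with }\varphi(T;t,x,u)\in\mathcal{X}\}$. The Hamiltonian is $H(t,x,p)=\max_{u\in\mathbb{U}}\langle -p,f(t,x,u)\rangle$. For an open set $\Omega\subseteq(0,T)\times\mathbb{R}^n$, a function $v\in C([0,T]\times\mathbb{R}^n;\mathbb{R})$ is a viscosity supersolution (resp. subsolution) of $-v_t+H(t,x,\nabla v)=0$ on $\Omega$ if for every $\xi\in C^1(\Omega;\mathbb{R})$ such that $v-\xi$ attains a local minimum (resp. local maximum) at $(t_0,x_0)\in\Omega$, one has $-\xi_t(t_0,x_0)+H(t_0,x_0,\nabla\xi(t_0,x_0))\ge 0$ (resp. $\le 0$). *)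

theory Defs
  imports "HOL-Analysis.Analysis"
begin

definition abs_continuous_on :: "real \<Rightarrow> real \<Rightarrow> (real \<Rightarrow> 'a::real_normed_vector) \<Rightarrow> bool" where
  "abs_continuous_on a b y \<longleftrightarrow>
     (\<forall>\<epsilon>>0. \<exists>\<delta>>0. \<forall>(N::nat) (c::nat \<Rightarrow> real) (d::nat \<Rightarrow> real).
        (\<forall>k<N. a \<le> c k \<and> c k \<le> d k \<and> d k \<le> b) \<and>
        (\<forall>i<N. \<forall>j<N. i \<noteq> j \<longrightarrow> d i \<le> c j \<or> d j \<le> c i) \<and>
        (\<Sum>k<N. d k - c k) < \<delta>
        \<longrightarrow> (\<Sum>k<N. norm (y (d k) - y (c k))) < \<epsilon>)"

definition controls :: "real \<Rightarrow> real \<Rightarrow> 'm::euclidean_space set \<Rightarrow> (real \<Rightarrow> 'm) set" where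
  "controls t T U = {u. u \<in> borel_measurable (lebesgue_on {t..T}) \<and> (\<forall>s\<in>{t..T}. u s \<in> U)}"

definition is_solution ::
  "(real \<Rightarrow> 'n::euclidean_space \<Rightarrow> 'm \<Rightarrow> 'n) \<Rightarrow> real \<Rightarrow> real \<Rightarrow> 'n \<Rightarrow> (real \<Rightarrow> 'm) \<Rightarrow> (real \<Rightarrow> 'n) \<Rightarrow> bool" where
  "is_solution f t T x u y \<longleftrightarrow>
     abs_continuous_on t T y \<and> y t = x \<and>
     (\<exists>Z. Z \<in> null_sets lebesgue \<and>
        (\<forall>s\<in>{t<..<T} - Z. (y has_vector_derivative f s (y s) (u s)) (at s)))"

definition traj ::
  "(real \<Rightarrow> 'n::euclidean_space \<Rightarrow> 'm \<Rightarrow> 'n) \<Rightarrow> real \<Rightarrow> real \<Rightarrow> 'n \<Rightarrow> (real \<Rightarrow> 'm) \<Rightarrow> real \<Rightarrow> 'n" where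
  "traj f T t x u s = (THE z. \<exists>y. is_solution f t T x u y \<and> y s = z)"

definition reach_set ::
  "(real \<Rightarrow> 'n::euclidean_space \<Rightarrow> 'm::euclidean_space \<Rightarrow> 'n) \<Rightarrow> 'm set \<Rightarrow> real \<Rightarrow> 'n set \<Rightarrow> real \<Rightarrow> 'n set" where
  "reach_set f U T X t = {x. \<exists>u\<in>controls t T U. traj f T t x u T \<in> X}"

definition hamiltonian ::
  "(real \<Rightarrow> 'n::euclidean_space \<Rightarrow> 'm \<Rightarrow> 'n) \<Rightarrow> 'm set \<Rightarrow> real \<Rightarrow> 'n \<Rightarrow> 'n \<Rightarrow> real" where
  "hamiltonian f U t x p = Sup ((\<lambda>u. (- p) \<bullet> f t x u) ` U)"

text \<open>Viscosity subsolution of -v_t + H(t,x,grad v) = 0 on the open set Omega.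
  A test function xi is C^1 on Omega, with partial derivatives xit (time) and xix (space gradient)
  continuous on Omega.\<close>
definition visc_subsolution ::
  "(real \<Rightarrow> 'n::euclidean_space \<Rightarrow> 'm \<Rightarrow> 'n) \<Rightarrow> 'm set \<Rightarrow> (real \<times> 'n) set \<Rightarrow> (real \<Rightarrow> 'n \<Rightarrow> real) \<Rightarrow> bool" where
  "visc_subsolution f U \<Omega> v \<longleftrightarrow>
     (\<forall>(\<xi>::real \<times> 'n \<Rightarrow> real) \<xi>t \<xi>x t0 x0.
        continuous_on \<Omega> \<xi>t \<and> continuous_on \<Omega> \<xi>x \<and>
        (\<forall>z\<in>\<Omega>. (\<xi> has_derivative (\<lambda>(h, k). \<xi>t z * h + \<xi>x z \<bullet> k)) (at z)) \<and>
        (t0, x0) \<in> \<Omega> \<and>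
        (\<exists>e>0. \<forall>z\<in>ball (t0, x0) e \<inter> \<Omega>. v (fst z) (snd z) - \<xi> z \<le> v t0 x0 - \<xi> (t0, x0))
        \<longrightarrow> - \<xi>t (t0, x0) + hamiltonian f U t0 x0 (\<xi>x (t0, x0)) \<le> 0)"

end

(*
  Along a trajectory y lying in the set where the subsolution v is positive, s |-> v s (y s) is
  nondecreasing.  So if v t x > 0, it cannot reach a first zero b: by continuity v b (y b) >=
  v a (y a) > 0 for t < a < b.  Hence v T (y T) > 0, which excludes g (y T) <= 0.

  For the monotonicity, y is replaced by its forward averages Y(s) = (1/h) * integral of y over
  [s, s+h], which are C^1.  As Y'(s) = (y(s+h) - y(s))/h is an average of values of f, it
  satisfies <-q, Y'(s)> <= H(s, Y(s), q) + |q| * eta with eta small for small h.  If v decreased from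
  a to c along y, then v(s,x) - k |x - Y(s)|^2 - psi(s), for a suitable decreasing psi that is
  steep near a, would have an interior maximum over a thin tube around Y; the subsolution inequality
  there bounds -psi' by an arbitrarily small number, while -psi' is bounded away from 0 on [a,c].

  The trajectory itself is defined by a description operator, so it denotes a solution only because
  the Caratheodory problem is uniquely solvable.
*)
theory Submission
  imports Defs
begin

text \<open>The monotonicity argument depends on the order in which its constants are chosen. At the
  maximum the spatial gradient is \<open>q = 2 k z0\<close>, where \<open>z0\<close> is the
  displacement from the averaged curve. The tube bounds it only by a multiple of
  \<open>m / \<sigma>\<close>, and the radius \<open>\<sigma>\<close> is dictated by the oscillation
  bound \<open>m\<close>, so \<open>q\<close> need not be small. Two errors carry the factor
  \<open>norm q\<close>. Moving the Hamiltonian to the centre of the tube costs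
  \<open>norm q * (L * norm z0)\<close>; this is quadratic in \<open>z0\<close>, like the penalty,
  and is at most \<open>4 * L * m\<close> whatever the radius. Averaging costs
  \<open>norm q * \<eta>\<close>, which is small only if \<open>\<eta>\<close> is chosen after
  \<open>\<sigma>\<close>. Hence \<open>\<psi>\<close> and \<open>m\<close> come first, then
  \<open>\<sigma>\<close>, then \<open>\<eta>\<close>, and last the window \<open>h\<close>. Since
  controls are merely measurable, a solution has a derivative only off a null set. Estimates for
  given solutions therefore rest on a mean value inequality for absolutely continuous functions,
  proved directly with gauges.\<close>

section \<open>Absolute continuity: basic closure properties\<close>

lemma abs_continuous_onI:
  assumes "\<And>e. e > 0 \<Longrightarrow> \<exists>\<delta>>0. \<forall>(N::nat) c d.
      (\<forall>k<N. a \<le> c k \<and> c k \<le> d k \<and> d k \<le> b) \<longrightarrow>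
      (\<forall>i<N. \<forall>j<N. i \<noteq> j \<longrightarrow> d i \<le> c j \<or> d j \<le> c i) \<longrightarrow>
      (\<Sum>k<N. d k - c k) < \<delta> \<longrightarrow> (\<Sum>k<N. norm (y (d k) - y (c k))) < e"
  shows "abs_continuous_on a b y"
  unfolding abs_continuous_on_def
proof (intro allI impI)
  fix e :: real assume "e > 0"
  from assms[OF this] show "\<exists>\<delta>>0. \<forall>(N::nat) c d.
      (\<forall>k<N. a \<le> c k \<and> c k \<le> d k \<and> d k \<le> b) \<and>
      (\<forall>i<N. \<forall>j<N. i \<noteq> j \<longrightarrow> d i \<le> c j \<or> d j \<le> c i) \<and>
      (\<Sum>k<N. d k - c k) < \<delta> \<longrightarrow> (\<Sum>k<N. norm (y (d k) - y (c k))) < e"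
    by (simp only: imp_conjL)
qed

lemma abs_continuous_onE:
  assumes "abs_continuous_on a b y" and "e > 0"
  obtains \<delta> where "\<delta> > 0"
    "\<And>(N::nat) c d. \<lbrakk>\<forall>k<N. a \<le> c k \<and> c k \<le> d k \<and> d k \<le> b;
      \<forall>i<N. \<forall>j<N. i \<noteq> j \<longrightarrow> d i \<le> c j \<or> d j \<le> c i;
      (\<Sum>k<N. d k - c k) < \<delta>\<rbrakk> \<Longrightarrow> (\<Sum>k<N. norm (y (d k) - y (c k))) < e"
proof -
  note * = assms(1)[unfolded abs_continuous_on_def imp_conjL, rule_format, OF assms(2)]
  show thesis using * by (elim exE conjE) (rule that, assumption, simp only: imp_conjL)
qed

text \<open>Enumerating the index set reduces this to families indexed by naturals. It is meant for
  the tagged intervals of a division, which are indexed by themselves.\<close>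

lemma abs_continuous_on_finite_family:
  assumes "abs_continuous_on a b y" and "e > 0"
  shows "\<exists>\<delta>>0. \<forall>(I::'i set) c d. finite I \<longrightarrow> (\<forall>i\<in>I. a \<le> c i \<and> c i \<le> d i \<and> d i \<le> b) \<longrightarrow>
        (\<forall>i\<in>I. \<forall>j\<in>I. i \<noteq> j \<longrightarrow> d i \<le> c j \<or> d j \<le> c i) \<longrightarrow> (\<Sum>i\<in>I. d i - c i) < \<delta> \<longrightarrow>
        (\<Sum>i\<in>I. norm (y (d i) - y (c i))) < e"
proof (rule abs_continuous_onE[OF assms], intro exI conjI allI impI, assumption)
  fix \<delta> :: real assume \<delta>: "\<And>(N::nat) c d. \<lbrakk>\<forall>k<N. a \<le> c k \<and> c k \<le> d k \<and> d k \<le> b;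
      \<forall>i<N. \<forall>j<N. i \<noteq> j \<longrightarrow> d i \<le> c j \<or> d j \<le> c i;
      (\<Sum>k<N. d k - c k) < \<delta>\<rbrakk> \<Longrightarrow> (\<Sum>k<N. norm (y (d k) - y (c k))) < e"
  fix I :: "'i set" and c d
  assume I: "finite I" and cd: "\<forall>i\<in>I. a \<le> c i \<and> c i \<le> d i \<and> d i \<le> b"
    and disj: "\<forall>i\<in>I. \<forall>j\<in>I. i \<noteq> j \<longrightarrow> d i \<le> c j \<or> d j \<le> c i"
    and less: "(\<Sum>i\<in>I. d i - c i) < \<delta>"
  obtain h where h: "bij_betw h {..<card I} I"
    using ex_bij_betw_nat_finite[OF I] by (metis lessThan_atLeast0)
  have hI: "h k \<in> I" if "k < card I" for k using h that by (auto simp: bij_betw_def)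
  have hne: "h i \<noteq> h j" if "i < card I" "j < card I" "i \<noteq> j" for i j
    using h that by (auto simp: bij_betw_def inj_on_def)
  have re: "(\<Sum>k<card I. F (h k)) = (\<Sum>i\<in>I. F i)" for F :: "'i \<Rightarrow> real"
    by (rule sum.reindex_bij_betw[OF h])
  have "(\<Sum>k<card I. norm (y (d (h k)) - y (c (h k)))) < e"
  proof (rule \<delta>)
    show "\<forall>k<card I. a \<le> c (h k) \<and> c (h k) \<le> d (h k) \<and> d (h k) \<le> b" using cd hI by simp
    show "\<forall>i<card I. \<forall>j<card I. i \<noteq> j \<longrightarrow> d (h i) \<le> c (h j) \<or> d (h j) \<le> c (h i)"
      using disj hI hne by simp
    show "(\<Sum>k<card I. d (h k) - c (h k)) < \<delta>" using less re[of "\<lambda>i. d i - c i"] by simp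
  qed
  then show "(\<Sum>i\<in>I. norm (y (d i) - y (c i))) < e"
    by (simp add: re[of "\<lambda>i. norm (y (d i) - y (c i))"])
qed

lemma abs_continuous_on_subinterval:
  assumes "abs_continuous_on a b y" "a \<le> c" "d \<le> b"
  shows "abs_continuous_on c d y"
proof (rule abs_continuous_onI)
  fix e :: real assume "e > 0"
  show "\<exists>\<delta>>0. \<forall>(N::nat) ca da.
        (\<forall>k<N. c \<le> ca k \<and> ca k \<le> da k \<and> da k \<le> d) \<longrightarrow>
        (\<forall>i<N. \<forall>j<N. i \<noteq> j \<longrightarrow> da i \<le> ca j \<or> da j \<le> ca i) \<longrightarrow>
        (\<Sum>k<N. da k - ca k) < \<delta> \<longrightarrow> (\<Sum>k<N. norm (y (da k) - y (ca k))) < e"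
  proof (rule abs_continuous_onE[OF assms(1) \<open>e > 0\<close>], intro exI conjI allI impI, assumption)
    fix \<delta> :: real and N :: nat and ca da
    assume \<delta>: "\<And>(N::nat) c d. \<lbrakk>\<forall>k<N. a \<le> c k \<and> c k \<le> d k \<and> d k \<le> b;
      \<forall>i<N. \<forall>j<N. i \<noteq> j \<longrightarrow> d i \<le> c j \<or> d j \<le> c i;
      (\<Sum>k<N. d k - c k) < \<delta>\<rbrakk> \<Longrightarrow> (\<Sum>k<N. norm (y (d k) - y (c k))) < e"
      and *: "\<forall>k<N. c \<le> ca k \<and> ca k \<le> da k \<and> da k \<le> d" 
        "\<forall>i<N. \<forall>j<N. i \<noteq> j \<longrightarrow> da i \<le> ca j \<or> da j \<le> ca i" "(\<Sum>k<N. da k - ca k) < \<delta>"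
    have "\<forall>k<N. a \<le> ca k \<and> ca k \<le> da k \<and> da k \<le> b" using *(1) assms(2,3) by (meson order_trans)
    then show "(\<Sum>k<N. norm (y (da k) - y (ca k))) < e" by (rule \<delta>[OF _ *(2,3)])
  qed
qed

lemma abs_continuous_on_imp_continuous_on:
  assumes "abs_continuous_on a b y"
  shows "continuous_on {a..b} y"
  unfolding continuous_on_iff
proof (intro ballI allI impI)
  fix x e :: real assume x: "x \<in> {a..b}" and "e > 0"
  show "\<exists>d>0. \<forall>x'\<in>{a..b}. dist x' x < d \<longrightarrow> dist (y x') (y x) < e"
  proof (rule abs_continuous_onE[OF assms \<open>e > 0\<close>], intro exI conjI ballI impI, assumption)
    fix \<delta> x' :: real
    assume \<delta>: "\<And>(N::nat) c d. \<lbrakk>\<forall>k<N. a \<le> c k \<and> c k \<le> d k \<and> d k \<le> b;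
      \<forall>i<N. \<forall>j<N. i \<noteq> j \<longrightarrow> d i \<le> c j \<or> d j \<le> c i;
      (\<Sum>k<N. d k - c k) < \<delta>\<rbrakk> \<Longrightarrow> (\<Sum>k<N. norm (y (d k) - y (c k))) < e"
      and x': "x' \<in> {a..b}" "dist x' x < \<delta>"
    have "norm (y (max x x') - y (min x x')) < e"
      using \<delta>[of 1 "\<lambda>_. min x x'" "\<lambda>_. max x x'"] x x'
      by (auto simp: dist_real_def min_def max_def)
    then show "dist (y x') (y x) < e"
      by (auto simp: dist_norm min_def max_def norm_minus_commute split: if_splits)
  qed
qed

lemma abs_continuous_on_bounded_linear:
  assumes "abs_continuous_on a b y" "bounded_linear A"
  shows "abs_continuous_on a b (\<lambda>s. A (y s))"
proof (rule abs_continuous_onI)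
  fix e :: real assume "e > 0"
  obtain K where K: "K > 0" "\<And>x. norm (A x) \<le> norm x * K"
    using bounded_linear.pos_bounded[OF assms(2)] by blast
  have "e / K > 0" using \<open>e > 0\<close> K by simp
  have A_diff: "norm (A u - A v) \<le> norm (u - v) * K" for u v
    using K(2)[of "u - v"] by (simp add: linear_diff[OF bounded_linear.linear[OF assms(2)]])
  show "\<exists>\<delta>>0. \<forall>(N::nat) c d.
        (\<forall>k<N. a \<le> c k \<and> c k \<le> d k \<and> d k \<le> b) \<longrightarrow>
        (\<forall>i<N. \<forall>j<N. i \<noteq> j \<longrightarrow> d i \<le> c j \<or> d j \<le> c i) \<longrightarrow>
        (\<Sum>k<N. d k - c k) < \<delta> \<longrightarrow> (\<Sum>k<N. norm (A (y (d k)) - A (y (c k)))) < e"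
  proof (rule abs_continuous_onE[OF assms(1) \<open>e / K > 0\<close>], intro exI conjI allI impI, assumption)
    fix \<delta> :: real and N :: nat and c d
    assume \<delta>: "\<And>(N::nat) c d. \<lbrakk>\<forall>k<N. a \<le> c k \<and> c k \<le> d k \<and> d k \<le> b;
      \<forall>i<N. \<forall>j<N. i \<noteq> j \<longrightarrow> d i \<le> c j \<or> d j \<le> c i;
      (\<Sum>k<N. d k - c k) < \<delta>\<rbrakk> \<Longrightarrow> (\<Sum>k<N. norm (y (d k) - y (c k))) < e / K"
      and *: "\<forall>k<N. a \<le> c k \<and> c k \<le> d k \<and> d k \<le> b" 
        "\<forall>i<N. \<forall>j<N. i \<noteq> j \<longrightarrow> d i \<le> c j \<or> d j \<le> c i" "(\<Sum>k<N. d k - c k) < \<delta>"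
    have "(\<Sum>k<N. norm (A (y (d k)) - A (y (c k)))) \<le> (\<Sum>k<N. norm (y (d k) - y (c k)) * K)"
      by (intro sum_mono A_diff)
    also have "\<dots> = (\<Sum>k<N. norm (y (d k) - y (c k))) * K" by (simp add: sum_distrib_right)
    also have "\<dots> < e" using \<delta>[OF *] K(1) by (simp add: field_simps)
    finally show "(\<Sum>k<N. norm (A (y (d k)) - A (y (c k)))) < e" .
  qed
qed

lemma abs_continuous_on_lipschitz:
  assumes "\<And>r s. \<lbrakk>a \<le> r; r \<le> s; s \<le> b\<rbrakk> \<Longrightarrow> norm (y s - y r) \<le> M * (s - r)" and "M > 0"
  shows "abs_continuous_on a b y"
proof (rule abs_continuous_onI)
  fix e :: real assume "e > 0"
  have "e / M > 0" using \<open>e > 0\<close> \<open>M > 0\<close> by simp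
  show "\<exists>\<delta>>0. \<forall>(N::nat) c d.
        (\<forall>k<N. a \<le> c k \<and> c k \<le> d k \<and> d k \<le> b) \<longrightarrow>
        (\<forall>i<N. \<forall>j<N. i \<noteq> j \<longrightarrow> d i \<le> c j \<or> d j \<le> c i) \<longrightarrow>
        (\<Sum>k<N. d k - c k) < \<delta> \<longrightarrow> (\<Sum>k<N. norm (y (d k) - y (c k))) < e"
  proof (rule exI[of _ "e / M"], intro conjI allI impI, fact)
    fix N :: nat and c d :: "nat \<Rightarrow> real"
    assume *: "\<forall>k<N. a \<le> c k \<and> c k \<le> d k \<and> d k \<le> b" "(\<Sum>k<N. d k - c k) < e / M"
    have "(\<Sum>k<N. norm (y (d k) - y (c k))) \<le> (\<Sum>k<N. M * (d k - c k))"
      using *(1) assms(1) by (intro sum_mono) auto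
    also have "\<dots> = M * (\<Sum>k<N. d k - c k)" by (simp add: sum_distrib_left)
    also have "\<dots> < e" using *(2) \<open>M > 0\<close> by (simp add: field_simps)
    finally show "(\<Sum>k<N. norm (y (d k) - y (c k))) < e" .
  qed
qed

section \<open>Mean value inequalities with derivatives known almost everywhere\<close>

text \<open>The one-sided straddle lemma of gauge integration. Because \<open>s\<close> lies between
  \<open>c\<close> and \<open>d\<close>, the linearization errors \<open>e * (d - s)\<close> and
  \<open>e * (s - c)\<close> add up to exactly \<open>e * (d - c)\<close>.\<close>

lemma straddle_upper:
  fixes \<phi> :: "real \<Rightarrow> real"
  assumes "(\<phi> has_real_derivative D) (at s)" "e > 0"
  obtains \<rho> where "\<rho> > 0" "\<And>c d. \<lbrakk>c \<le> s; s \<le> d; \<bar>c - s\<bar> < \<rho>; \<bar>d - s\<bar> < \<rho>\<rbrakk> \<Longrightarrow> \<phi> d - \<phi> c \<le> (D + e) * (d - c)"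
proof -
  obtain \<rho> where \<rho>: "\<rho> > 0" "\<And>x. \<bar>x - s\<bar> < \<rho> \<Longrightarrow> \<bar>\<phi> x - \<phi> s - D * (x - s)\<bar> \<le> e * \<bar>x - s\<bar>"
    using assms unfolding has_field_derivative_def has_derivative_at_alt by fastforce
  show thesis
  proof (rule that[OF \<rho>(1)])
    fix c d assume *: "c \<le> s" "s \<le> d" "\<bar>c - s\<bar> < \<rho>" "\<bar>d - s\<bar> < \<rho>"
    have "\<phi> d - \<phi> s - D * (d - s) \<le> e * (d - s)" using \<rho>(2)[of d] * by auto
    moreover have "- (\<phi> c - \<phi> s - D * (c - s)) \<le> e * (s - c)" using \<rho>(2)[of c] * by auto
    ultimately show "\<phi> d - \<phi> c \<le> (D + e) * (d - c)" by (simp add: algebra_simps)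
  qed
qed

text \<open>In a tagged division fine for a suitable gauge, the intervals tagged outside \<open>Z\<close> are controlled by
  the derivative; those tagged in \<open>Z\<close> lie in an open set of small measure, so absolute continuity
  makes their total contribution small.\<close>
lemma abs_continuous_on_diff_le:
  fixes \<phi> \<phi>' :: "real \<Rightarrow> real"
  assumes ac: "abs_continuous_on a b \<phi>" and ab: "a \<le> b" and Z: "Z \<in> null_sets lebesgue"
    and der: "\<And>s. s \<in> {a<..<b} - Z \<Longrightarrow> (\<phi> has_real_derivative \<phi>' s) (at s)"
    and le: "\<And>s. s \<in> {a<..<b} - Z \<Longrightarrow> \<phi>' s \<le> M"
  shows "\<phi> b - \<phi> a \<le> M * (b - a)"
proof (rule field_le_epsilon)
  fix E :: real assume "E > 0"
  \<comment> \<open>The budget: \<open>e * (b - a)\<close> for the slack on the intervals tagged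
    outside the null set, and one \<open>e\<close> each for the variation and the length of the
    exceptional intervals.\<close>
  define e where "e = E / (b - a + 2)"
  have "e > 0" using \<open>E > 0\<close> ab by (simp add: e_def)
  obtain \<delta>0 where "\<delta>0 > 0" and \<delta>0:
    "\<forall>(I::(real \<times> real set) set) c d. finite I \<longrightarrow> (\<forall>i\<in>I. a \<le> c i \<and> c i \<le> d i \<and> d i \<le> b) \<longrightarrow>
        (\<forall>i\<in>I. \<forall>j\<in>I. i \<noteq> j \<longrightarrow> d i \<le> c j \<or> d j \<le> c i) \<longrightarrow> (\<Sum>i\<in>I. d i - c i) < \<delta>0 \<longrightarrow>
        (\<Sum>i\<in>I. norm (\<phi> (d i) - \<phi> (c i))) < e"
    using abs_continuous_on_finite_family[OF ac \<open>e > 0\<close>] by (elim exE conjE) (rule that)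
  \<comment> \<open>The first entry comes from absolute continuity; the second makes
    \<open>\<bar>M + e\<bar>\<close> times the exceptional length at most \<open>e\<close>. The
    summand 1 keeps the denominator positive.\<close>
  define \<delta> where "\<delta> = min \<delta>0 (e / (\<bar>M + e\<bar> + 1))"
  have "\<delta> > 0" using \<open>\<delta>0 > 0\<close> \<open>e > 0\<close> by (simp add: \<delta>_def add_nonneg_pos)
  \<comment> \<open>The derivative is assumed only on the open interval, so the endpoints join the
    exceptional set.\<close>
  define Z' where "Z' = Z \<union> {a, b}"
  have "{a, b} \<in> null_sets lebesgue" by (intro null_sets_completionI finite_imp_null_set_lborel) auto
  then have Z': "Z' \<in> null_sets lebesgue" using Z by (auto simp: Z'_def)
  obtain G where G: "open G" "Z' \<subseteq> G" "G - Z' \<in> lmeasurable" "emeasure lebesgue (G - Z') < ennreal \<delta>"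
    using sets_lebesgue_outer_open[of Z' \<delta>] Z' \<open>\<delta> > 0\<close> by blast
  have "emeasure lebesgue G = emeasure lebesgue (G - Z')"
    using emeasure_Diff_null_set[OF Z', of G] G(1) by auto
  then have G\<delta>: "emeasure lebesgue G < ennreal \<delta>" using G(4) by simp
  then have Gm: "G \<in> lmeasurable" using G(1)
    by (intro fmeasurableI) (auto simp: less_top[symmetric] dest: order.strict_trans[OF _ ennreal_less_top])
  have G\<delta>': "measure lebesgue G < \<delta>"
    using G\<delta> \<open>\<delta> > 0\<close> Gm by (metis emeasure_eq_measure2 ennreal_less_iff measure_nonneg)
  have "\<exists>\<rho>>0. (s \<in> Z' \<longrightarrow> ball s \<rho> \<subseteq> G) \<and>
      (s \<in> {a..b} - Z' \<longrightarrow> (\<forall>c d. c \<le> s \<longrightarrow> s \<le> d \<longrightarrow> \<bar>c - s\<bar> < \<rho> \<longrightarrow> \<bar>d - s\<bar> < \<rho> \<longrightarrow> \<phi> d - \<phi> c \<le> (M + e) * (d - c)))" for s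
  proof (cases "s \<in> Z'")
    case True
    then show ?thesis using G(1,2) openE by blast
  next
    case False
    show ?thesis
    proof (cases "s \<in> {a..b}")
      case True
      then have s: "s \<in> {a<..<b} - Z" using False by (auto simp: Z'_def)
      obtain \<rho> where "\<rho> > 0" and
        \<rho>: "\<And>c d. \<lbrakk>c \<le> s; s \<le> d; \<bar>c - s\<bar> < \<rho>; \<bar>d - s\<bar> < \<rho>\<rbrakk> \<Longrightarrow> \<phi> d - \<phi> c \<le> (\<phi>' s + e) * (d - c)"
        using straddle_upper[OF der[OF s] \<open>e > 0\<close>] by metis
      have "(\<phi>' s + e) * (d - c) \<le> (M + e) * (d - c)" if "c \<le> s" "s \<le> d" for c d
        using le[OF s] that by (intro mult_right_mono) auto
      then show ?thesis using \<open>\<rho> > 0\<close> \<rho> False by (intro exI[of _ \<rho>]) force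
    qed (use False in \<open>auto intro: exI[of _ 1]\<close>)
  qed
  then obtain \<rho> where \<rho>: "\<And>s. \<rho> s > 0" "\<And>s. s \<in> Z' \<Longrightarrow> ball s (\<rho> s) \<subseteq> G"
    "\<And>s c d. \<lbrakk>s \<in> {a..b} - Z'; c \<le> s; s \<le> d; \<bar>c - s\<bar> < \<rho> s; \<bar>d - s\<bar> < \<rho> s\<rbrakk> \<Longrightarrow> \<phi> d - \<phi> c \<le> (M + e) * (d - c)"
    by metis
  have "gauge (\<lambda>s. ball s (\<rho> s))" using \<rho>(1) by (intro gauge_ball_dependent) auto
  then obtain p where p: "p tagged_division_of {a..b}" "(\<lambda>s. ball s (\<rho> s)) fine p"
    using fine_division_exists_real by blast
  have pK: "\<exists>c d. K = {c..d} \<and> c \<le> d \<and> a \<le> c \<and> d \<le> b \<and> c \<le> s \<and> s \<le> d \<and> s \<in> {a..b} \<and> K \<subseteq> ball s (\<rho> s)" if sK: "(s, K) \<in> p" for s K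
  proof -
    have "s \<in> K" "K \<subseteq> {a..b}" "\<exists>c d. K = cbox c d" using tagged_division_ofD(2-4)[OF p(1) sK] by auto
    moreover have "K \<subseteq> ball s (\<rho> s)" using p(2) sK by (auto simp: fine_def)
    ultimately show ?thesis by (fastforce simp: subset_iff)
  qed
  \<comment> \<open>Degenerate intervals are left out: having empty interior, they could sit inside
    another interval of the division and spoil the ordering required by absolute continuity. Their
    increments vanish anyway.\<close>
  define B where "B = {i \<in> p. fst i \<in> Z' \<and> Inf (snd i) < Sup (snd i)}"
  have fin: "finite p" using p(1) by blast
  have "finite B" using fin by (simp add: B_def)
  have Bcd: "a \<le> Inf (snd i) \<and> Inf (snd i) \<le> Sup (snd i) \<and> Sup (snd i) \<le> b" if "i \<in> B" for i
    using that pK[of "fst i" "snd i"] by (auto simp: B_def)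
  have Bdisj: "Sup (snd i) \<le> Inf (snd j) \<or> Sup (snd j) \<le> Inf (snd i)" if ij: "i \<in> B" "j \<in> B" "i \<noteq> j" for i j
  proof -
    obtain c d where cd: "snd i = {c..d}" "c < d" using ij pK[of "fst i" "snd i"] by (fastforce simp: B_def)
    obtain c' d' where cd': "snd j = {c'..d'}" "c' < d'" using ij pK[of "fst j" "snd j"] by (fastforce simp: B_def)
    have "interior (snd i) \<inter> interior (snd j) = {}"
      using tagged_division_ofD(5)[OF p(1), of "fst i" "snd i" "fst j" "snd j"] that by (auto simp: B_def)
    then have "{c<..<d} \<inter> {c'<..<d'} = {}" using cd cd' by simp
    then have "\<not> (max c c' < min d d')" 
      using dense[of "max c c'" "min d d'"] by (metis Int_iff empty_iff greaterThanLessThan_iff max_less_iff_conj min_less_iff_conj)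
    then show ?thesis using cd cd' by auto
  qed
  have Bsum: "(\<Sum>i\<in>B. Sup (snd i) - Inf (snd i)) \<le> measure lebesgue G"
  proof -
    have Bp: "B \<subseteq> p" by (auto simp: B_def)
    have "(\<Sum>i\<in>B. Sup (snd i) - Inf (snd i)) = (\<Sum>i\<in>B. measure lebesgue (snd i))"
    proof (rule sum.cong[OF refl])
      fix i assume "i \<in> B"
      then obtain c d where "snd i = {c..d}" "c \<le> d" using pK[of "fst i" "snd i"] Bp by auto
      then show "Sup (snd i) - Inf (snd i) = measure lebesgue (snd i)" by simp
    qed
    also have "\<dots> = measure lebesgue (\<Union>i\<in>B. snd i)"
    proof (rule measure_negligible_finite_Union_image[symmetric])
      show "finite B" by fact
      show "snd i \<in> lmeasurable" if "i \<in> B" for i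
        using that pK[of "fst i" "snd i"] Bp by (metis lmeasurable_cbox cbox_interval prod.collapse subsetD)
      show "pairwise (\<lambda>i j. negligible (snd i \<inter> snd j)) B"
      proof (rule pairwiseI)
        fix i j assume ij: "i \<in> B" "j \<in> B" "i \<noteq> j"
        obtain c d where cd: "snd i = {c..d}" "c < d" using ij pK[of "fst i" "snd i"] by (fastforce simp: B_def)
        obtain c' d' where cd': "snd j = {c'..d'}" "c' < d'" using ij pK[of "fst j" "snd j"] by (fastforce simp: B_def)
        have "snd i \<inter> snd j \<subseteq> {d, d'}" using Bdisj[OF ij] cd cd' by auto
        then show "negligible (snd i \<inter> snd j)" by (meson finite.emptyI finite_insert finite_subset negligible_finite)
      qed
    qed
    also have "\<dots> \<le> measure lebesgue G"
    proof (rule measure_mono_fmeasurable[OF _ _ Gm])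
      show "(\<Union>i\<in>B. snd i) \<subseteq> G" using pK \<rho>(2) Bp unfolding B_def by fastforce
      show "(\<Union>i\<in>B. snd i) \<in> sets lebesgue"
      proof (rule sets.finite_UN[OF \<open>finite B\<close>])
        fix i assume "i \<in> B"
        then obtain c d where "snd i = {c..d}" using pK[of "fst i" "snd i"] Bp by auto
        then show "snd i \<in> sets lebesgue" by simp
      qed
    qed
    finally show ?thesis .
  qed
  have Bvar: "(\<Sum>i\<in>B. norm (\<phi> (Sup (snd i)) - \<phi> (Inf (snd i)))) < e"
    using \<delta>0[rule_format, of B "\<lambda>i. Inf (snd i)" "\<lambda>i. Sup (snd i)"] \<open>finite B\<close> Bcd Bdisj Bsum G\<delta>' by (auto simp: \<delta>_def)
  have Blen: "\<bar>M + e\<bar> * (\<Sum>i\<in>B. Sup (snd i) - Inf (snd i)) \<le> e"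
  proof -
    have "\<bar>M + e\<bar> * (\<Sum>i\<in>B. Sup (snd i) - Inf (snd i)) \<le> (\<bar>M + e\<bar> + 1) * (e / (\<bar>M + e\<bar> + 1))"
      using Bsum G\<delta>' Bcd by (intro mult_mono sum_nonneg) (auto simp: \<delta>_def)
    also have "\<dots> = e" by (simp add: add_nonneg_pos)
    finally show ?thesis .
  qed
  \<comment> \<open>The term \<open>\<bar>M + e\<bar>\<close> times the length compensates the main
    term on exceptional intervals, where \<open>M + e\<close> may be negative.\<close>
  have increment: "\<phi> (Sup (snd i)) - \<phi> (Inf (snd i)) \<le> (M + e) * (Sup (snd i) - Inf (snd i)) +
      (if i \<in> B then norm (\<phi> (Sup (snd i)) - \<phi> (Inf (snd i))) + \<bar>M + e\<bar> * (Sup (snd i) - Inf (snd i)) else 0)"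
    if ip: "i \<in> p" for i
  proof -
    obtain s K where i: "i = (s, K)" by (cases i)
    obtain c d where cd: "K = {c..d}" "c \<le> d" "a \<le> c" "d \<le> b" "c \<le> s" "s \<le> d" "s \<in> {a..b}" "K \<subseteq> ball s (\<rho> s)"
      using pK[of s K] ip i by blast
    consider "i \<in> B" | "c = d" | "s \<notin> Z'" using ip i cd by (fastforce simp: B_def)
    then show ?thesis
    proof cases
      case 1
      have "0 \<le> (M + e + \<bar>M + e\<bar>) * (d - c)" using cd(2) by (intro mult_nonneg_nonneg) auto
      then have "0 \<le> (M + e) * (d - c) + \<bar>M + e\<bar> * (d - c)" by (simp only: distrib_right)
      then show ?thesis using 1 cd i by (simp)
    next
      case 2
      then show ?thesis using cd i by auto
    next
      case 3
      moreover have "c \<in> K" "d \<in> K" using cd by auto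
      then have "c \<in> ball s (\<rho> s)" "d \<in> ball s (\<rho> s)" using cd(8) by blast+
      ultimately have "\<phi> d - \<phi> c \<le> (M + e) * (d - c)" using cd
        by (intro \<rho>(3)[of s]) (auto simp: dist_real_def abs_minus_commute)
      then show ?thesis using 3 i cd by (auto simp: B_def)
    qed
  qed
  have len: "(\<Sum>i\<in>p. Sup (snd i) - Inf (snd i)) = b - a"
    using additive_tagged_division_1[OF ab p(1), of "\<lambda>x. x"] by (simp add: case_prod_beta)
  have "\<phi> b - \<phi> a = (\<Sum>i\<in>p. \<phi> (Sup (snd i)) - \<phi> (Inf (snd i)))"
    using additive_tagged_division_1[OF ab p(1), of \<phi>] by (simp add: case_prod_beta)
  also have "\<dots> \<le> (\<Sum>i\<in>p. (M + e) * (Sup (snd i) - Inf (snd i)) +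
      (if i \<in> B then norm (\<phi> (Sup (snd i)) - \<phi> (Inf (snd i))) + \<bar>M + e\<bar> * (Sup (snd i) - Inf (snd i)) else 0))"
    by (intro sum_mono increment)
  also have "\<dots> = (M + e) * (b - a) + ((\<Sum>i\<in>B. norm (\<phi> (Sup (snd i)) - \<phi> (Inf (snd i)))) +
     \<bar>M + e\<bar> * (\<Sum>i\<in>B. Sup (snd i) - Inf (snd i)))"
  proof -
    have "B = p \<inter> B" by (auto simp: B_def)
    then have "(\<Sum>i\<in>p. if i \<in> B then F i else 0) = (\<Sum>i\<in>B. F i)" for F :: "real \<times> real set \<Rightarrow> real"
      using sum.inter_restrict[OF fin, of F B] by simp
    then show ?thesis by (simp add: sum.distrib sum_distrib_left[symmetric] len)
  qed
  also have "\<dots> \<le> (M + e) * (b - a) + (e + e)" using Bvar Blen by linarith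
  also have "\<dots> = M * (b - a) + e * (b - a + 2)" by (simp add: algebra_simps)
  also have "\<dots> = M * (b - a) + E" using ab by (simp add: e_def)
  finally show "\<phi> b - \<phi> a \<le> M * (b - a) + E" .
qed

text \<open>Pairing \<open>y\<close> with the fixed vector \<open>q = y b - y a\<close> gives a
  scalar function to which the one-sided inequality applies; dividing by \<open>norm q\<close>
  finishes.\<close>

lemma abs_continuous_on_norm_diff_le:
  fixes y y' :: "real \<Rightarrow> 'a::real_inner"
  assumes ac: "abs_continuous_on a b y" and ab: "a \<le> b" and "0 \<le> M" and Z: "Z \<in> null_sets lebesgue"
    and der: "\<And>s. s \<in> {a<..<b} - Z \<Longrightarrow> (y has_vector_derivative y' s) (at s)"
    and le: "\<And>s. s \<in> {a<..<b} - Z \<Longrightarrow> norm (y' s) \<le> M"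
  shows "norm (y b - y a) \<le> M * (b - a)"
proof -
  define q where "q = y b - y a"
  have "q \<bullet> y b - q \<bullet> y a \<le> (norm q * M) * (b - a)"
  proof (rule abs_continuous_on_diff_le[OF _ ab Z])
    show "abs_continuous_on a b (\<lambda>s. q \<bullet> y s)"
      by (rule abs_continuous_on_bounded_linear[OF ac bounded_linear_inner_right])
    fix s assume s: "s \<in> {a<..<b} - Z"
    show "((\<lambda>s. q \<bullet> y s) has_real_derivative q \<bullet> y' s) (at s)"
      using bounded_linear.has_vector_derivative[OF bounded_linear_inner_right der[OF s]]
      by (simp add: has_real_derivative_iff_has_vector_derivative)
    have "q \<bullet> y' s \<le> norm q * norm (y' s)" by (rule norm_cauchy_schwarz)
    also have "\<dots> \<le> norm q * M" by (intro mult_left_mono le s) auto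
    finally show "q \<bullet> y' s \<le> norm q * M" .
  qed
  then have "norm q * norm q \<le> norm q * (M * (b - a))"
    by (simp add: q_def inner_diff_right[symmetric] power2_norm_eq_inner[symmetric] power2_eq_square mult.assoc)
  then show ?thesis using ab \<open>0 \<le> M\<close> by (cases "q = 0") (simp_all add: q_def)
qed

section \<open>Differentiation of indefinite integrals\<close>

text \<open>Convergence of the averages over \<open>{s..s + h}\<close> gives the right derivative;
  the same theorem for the reflected function gives the left one. The null set depends on
  \<open>g\<close> alone, hence serves every lower limit \<open>a\<close>.\<close>

lemma integral_has_vector_derivative_ae:
  fixes g :: "real \<Rightarrow> 'a::euclidean_space"
  assumes int: "\<And>a b. g integrable_on {a..b}"
  obtains N where "N \<in> null_sets lebesgue"
    "\<And>a s. \<lbrakk>s \<notin> N; a < s\<rbrakk> \<Longrightarrow> ((\<lambda>s. integral {a..s} g) has_vector_derivative g s) (at s)"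
proof -
  have int': "(\<lambda>r. g (- r)) integrable_on {a..b}" for a b
    using int[of "-b" "-a"] Henstock_Kurzweil_Integration.integrable_reflect_real[where f = g and a = "- b" and b = "- a"] by simp
  obtain N1 where N1: "negligible N1" "\<And>x e. \<lbrakk>x \<notin> N1; 0 < e\<rbrakk> \<Longrightarrow>
      \<exists>d>0. \<forall>h. 0 < h \<and> h < d \<longrightarrow> norm (integral {x..x + h} g /\<^sub>R h - g x) < e"
    using integrable_ccontinuous_explicit[of g] int by (auto simp: cbox_interval)
  obtain N2 where N2: "negligible N2" "\<And>x e. \<lbrakk>x \<notin> N2; 0 < e\<rbrakk> \<Longrightarrow>
      \<exists>d>0. \<forall>h. 0 < h \<and> h < d \<longrightarrow> norm (integral {x..x + h} (\<lambda>r. g (- r)) /\<^sub>R h - g (- x)) < e"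
    using integrable_ccontinuous_explicit[of "\<lambda>r. g (- r)"] int' by (auto simp: cbox_interval)
  show thesis
  proof (rule that)
    have "negligible (uminus ` N2)"
    proof (rule negligible_locally_Lipschitz_image[OF _ N2(1)])
      show "\<exists>T B. open T \<and> x \<in> T \<and> (\<forall>y\<in>N2 \<inter> T. norm (- y - - x) \<le> B * norm (y - x))" for x
        by (rule exI[of _ UNIV], rule exI[of _ 1]) auto
    qed simp
    then show "N1 \<union> uminus ` N2 \<in> null_sets lebesgue"
      using N1(1) by (simp add: negligible_iff_null_sets[symmetric])
    fix a s assume s: "s \<notin> N1 \<union> uminus ` N2" and "a < s"
    have "- s \<notin> N2" using s by (metis UnI2 image_eqI minus_minus)
    show "((\<lambda>s. integral {a..s} g) has_vector_derivative g s) (at s)"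
      unfolding has_vector_derivative_def has_derivative_at_alt
    proof (intro conjI allI impI bounded_linear_scaleR_left)
      fix e :: real assume "e > 0"
      obtain d1 where d1: "d1 > 0" "\<And>h. \<lbrakk>0 < h; h < d1\<rbrakk> \<Longrightarrow> norm (integral {s..s + h} g /\<^sub>R h - g s) < e"
        using N1(2)[of s e] s \<open>e > 0\<close> by auto
      obtain d2 where d2: "d2 > 0" "\<And>h. \<lbrakk>0 < h; h < d2\<rbrakk> \<Longrightarrow> norm (integral {- s..- s + h} (\<lambda>r. g (- r)) /\<^sub>R h - g s) < e"
        using N2(2)[of "- s" e] \<open>- s \<notin> N2\<close> \<open>e > 0\<close> by auto
      have scale: "norm (v - h *\<^sub>R g s) \<le> e * h" if "norm (v /\<^sub>R h - g s) < e" "h > 0" for v h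
      proof -
        have "v - h *\<^sub>R g s = h *\<^sub>R (v /\<^sub>R h - g s)" using that(2) by (simp add: scaleR_diff_right)
        then show ?thesis using that by (simp add: mult.commute)
      qed
      have "norm (integral {a..y} g - integral {a..s} g - (y - s) *\<^sub>R g s) \<le> e * norm (y - s)"
        if y: "norm (y - s) < min (min d1 d2) (s - a)" for y
      proof -
        consider "y = s" | "s < y" | "y < s" by linarith
        then show ?thesis
        proof cases
          case 2
          have "integral {a..y} g = integral {a..s} g + integral {s..y} g"
            using Henstock_Kurzweil_Integration.integral_combine[of a s y g] int \<open>a < s\<close> 2 by simp
          then show ?thesis using scale[OF d1(2)[of "y - s"]] 2 y by simp
        next
          case 3
          have "integral {a..s} g = integral {a..y} g + integral {y..s} g"
            using Henstock_Kurzweil_Integration.integral_combine[of a y s g] int 3 y by simp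
          moreover have "integral {- s..- s + (s - y)} (\<lambda>r. g (- r)) = integral {y..s} g"
            using Henstock_Kurzweil_Integration.integral_reflect_real[of s y g] by simp
          ultimately have "norm (integral {a..s} g - integral {a..y} g - (s - y) *\<^sub>R g s) \<le> e * (s - y)"
            using scale[OF d2(2)[of "s - y"]] 3 y by simp
          moreover have "integral {a..s} g - integral {a..y} g - (s - y) *\<^sub>R g s =
              - (integral {a..y} g - integral {a..s} g - (y - s) *\<^sub>R g s)" by (simp add: algebra_simps)
          ultimately show ?thesis using 3 by (simp only: norm_minus_cancel real_norm_def abs_if) simp
        qed simp
      qed
      then show "\<exists>d>0. \<forall>y. norm (y - s) < d \<longrightarrow>
          norm (integral {a..y} g - integral {a..s} g - (y - s) *\<^sub>R g s) \<le> e * norm (y - s)"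
        using d1(1) d2(1) \<open>a < s\<close> by (intro exI[of _ "min (min d1 d2) (s - a)"]) auto
    qed
  qed
qed

lemma has_integral_exp:
  fixes l a b :: real
  assumes "l > 0" "a \<le> b"
  shows "((\<lambda>r. exp (l * r)) has_integral (exp (l * b) - exp (l * a)) / l) {a..b}"
proof -
  have "((\<lambda>r. exp (l * r)) has_integral (exp (l * b) / l - exp (l * a) / l)) {a..b}"
    using assms(1) by (intro fundamental_theorem_of_calculus[OF assms(2)])
      (auto intro!: derivative_eq_intros simp: has_real_derivative_iff_has_vector_derivative[symmetric])
  then show ?thesis by (simp add: diff_divide_distrib)
qed

section \<open>The control system: a priori bounds and uniqueness of solutions\<close>

locale control_system =
  fixes f :: "real \<Rightarrow> 'n::euclidean_space \<Rightarrow> 'm::euclidean_space \<Rightarrow> 'n" and U :: "'m set" and T L :: real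
  assumes U_compact: "compact U" and U_nonempty: "U \<noteq> {}"
    and f_continuous: "continuous_on ({0..T} \<times> UNIV \<times> U) (\<lambda>(s, x, u). f s x u)"
    and f_lipschitz: "\<And>s x y u. \<lbrakk>s \<in> {0..T}; u \<in> U\<rbrakk> \<Longrightarrow> norm (f s x u - f s y u) \<le> L * norm (x - y)"
    and L_nonneg: "0 \<le> L"
begin

lemma f_bounded:
  obtains B where "B > 0" "\<And>s x u. \<lbrakk>s \<in> {0..T}; norm x \<le> R; u \<in> U\<rbrakk> \<Longrightarrow> norm (f s x u) \<le> B"
proof -
  have "compact ((\<lambda>(s, x, u). f s x u) ` ({0..T} \<times> cball 0 R \<times> U))"
    by (intro compact_continuous_image continuous_on_subset[OF f_continuous] compact_Times U_compact) auto
  then obtain B where "B > 0" and B: "\<forall>z \<in> (\<lambda>(s, x, u). f s x u) ` ({0..T} \<times> cball 0 R \<times> U). norm z \<le> B"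
    using compact_imp_bounded bounded_pos by blast
  have "norm (f s x u) \<le> B" if "s \<in> {0..T}" "norm x \<le> R" "u \<in> U" for s x u
    using that by (intro B[rule_format]) (auto intro!: rev_image_eqI[of "(s, x, u)"])
  then show thesis using that[OF \<open>B > 0\<close>] by blast
qed

text \<open>A solution is continuous, so it stays in a ball, on which \<open>f\<close> is bounded by
  compactness of \<open>U\<close>. The mean value inequality then upgrades absolute continuity to a
  Lipschitz bound.\<close>

lemma solution_lipschitz:
  assumes u: "u \<in> controls t T U" and t: "0 \<le> t" and y: "is_solution f t T x u y"
  obtains B where "B > 0" "\<And>r s. \<lbrakk>t \<le> r; r \<le> s; s \<le> T\<rbrakk> \<Longrightarrow> norm (y s - y r) \<le> B * (s - r)"
proof -
  have ac: "abs_continuous_on t T y" using y by (simp add: is_solution_def)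
  obtain Z where Z: "Z \<in> null_sets lebesgue"
    "\<And>s. s \<in> {t<..<T} - Z \<Longrightarrow> (y has_vector_derivative f s (y s) (u s)) (at s)"
    using y by (auto simp: is_solution_def)
  have "compact (y ` {t..T})"
    by (intro compact_continuous_image abs_continuous_on_imp_continuous_on ac compact_Icc)
  then obtain R where R: "\<forall>s\<in>{t..T}. norm (y s) \<le> R"
    using compact_imp_bounded[of "y ` {t..T}"] by (auto simp: bounded_iff)
  obtain B where B: "B > 0" "\<And>s x u. \<lbrakk>s \<in> {0..T}; norm x \<le> R; u \<in> U\<rbrakk> \<Longrightarrow> norm (f s x u) \<le> B"
    by (rule f_bounded[of R]) (rule that)
  show thesis
  proof (rule that[OF B(1)])
    fix r s assume rs: "t \<le> r" "r \<le> s" "s \<le> T"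
    show "norm (y s - y r) \<le> B * (s - r)"
    proof (rule abs_continuous_on_norm_diff_le[OF _ rs(2) _ Z(1), where y' = "\<lambda>s. f s (y s) (u s)"])
      show "abs_continuous_on r s y" using abs_continuous_on_subinterval[OF ac] rs by blast
      fix q assume q: "q \<in> {r<..<s} - Z"
      show "(y has_vector_derivative f q (y q) (u q)) (at q)" using q rs by (intro Z(2)) auto
      show "norm (f q (y q) (u q)) \<le> B" using q rs t u R by (intro B(2)) (auto simp: controls_def)
    qed (use B(1) in simp)
  qed
qed

text \<open>Let \<open>r\<close> be the last time up to \<open>s1\<close> at which the solutions
  agree. On a window after \<open>r\<close> so short that \<open>L * h \<le> 1 / 2\<close>, the
  maximum of the distance is at most half of itself, so they agree beyond \<open>r\<close>.\<close>

lemma solution_unique: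
  assumes u: "u \<in> controls t T U" and t: "0 \<le> t"
    and y1: "is_solution f t T x u y1" and y2: "is_solution f t T x u y2" and s1: "s1 \<in> {t..T}"
  shows "y1 s1 = y2 s1"
proof (rule ccontr)
  assume "y1 s1 \<noteq> y2 s1"
  define z where "z s = y1 s - y2 s" for s
  obtain B1 where B1: "B1 > 0" "\<And>r s. \<lbrakk>t \<le> r; r \<le> s; s \<le> T\<rbrakk> \<Longrightarrow> norm (y1 s - y1 r) \<le> B1 * (s - r)"
    by (rule solution_lipschitz[OF u t y1]) (rule that)
  obtain B2 where B2: "B2 > 0" "\<And>r s. \<lbrakk>t \<le> r; r \<le> s; s \<le> T\<rbrakk> \<Longrightarrow> norm (y2 s - y2 r) \<le> B2 * (s - r)"
    by (rule solution_lipschitz[OF u t y2]) (rule that)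
  have z_ac: "abs_continuous_on t T z"
  proof (rule abs_continuous_on_lipschitz)
    show "B1 + B2 > 0" using B1(1) B2(1) by simp
    fix r s assume rs: "t \<le> r" "r \<le> s" "s \<le> T"
    have "norm (z s - z r) = norm ((y1 s - y1 r) - (y2 s - y2 r))" by (simp add: z_def algebra_simps)
    also have "\<dots> \<le> norm (y1 s - y1 r) + norm (y2 s - y2 r)" by (rule norm_triangle_ineq4)
    also have "\<dots> \<le> (B1 + B2) * (s - r)" using B1(2)[OF rs] B2(2)[OF rs] by (simp add: distrib_right)
    finally show "norm (z s - z r) \<le> (B1 + B2) * (s - r)" .
  qed
  obtain Z1 where Z1: "Z1 \<in> null_sets lebesgue"
    "\<And>s. s \<in> {t<..<T} - Z1 \<Longrightarrow> (y1 has_vector_derivative f s (y1 s) (u s)) (at s)"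
    using y1 by (auto simp: is_solution_def)
  obtain Z2 where Z2: "Z2 \<in> null_sets lebesgue"
    "\<And>s. s \<in> {t<..<T} - Z2 \<Longrightarrow> (y2 has_vector_derivative f s (y2 s) (u s)) (at s)"
    using y2 by (auto simp: is_solution_def)
  have z_cont: "continuous_on {t..T} z" by (rule abs_continuous_on_imp_continuous_on[OF z_ac])
  define K where "K = {s \<in> {t..s1}. z s = 0}"
  have "closed K" unfolding K_def
    by (intro continuous_closed_preimage_constant continuous_on_subset[OF z_cont]) (use s1 in auto)
  moreover have "t \<in> K" using s1 y1 y2 by (auto simp: K_def z_def is_solution_def)
  moreover have "bdd_above K" by (auto simp: K_def)
  ultimately have "Sup K \<in> K" using closed_contains_Sup by blast
  define r where "r = Sup K"
  have r: "t \<le> r" "z r = 0" "r < s1"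
    using \<open>Sup K \<in> K\<close> \<open>y1 s1 \<noteq> y2 s1\<close> by (auto simp: K_def r_def z_def less_eq_real_def)
  have after: "z s \<noteq> 0" if "r < s" "s \<le> s1" for s
    using that r(1) cSup_upper[OF _ \<open>bdd_above K\<close>, of s] by (force simp: r_def K_def)
  define h where "h = min (s1 - r) (1 / (2 * L + 1))"
  have h: "h > 0" "r + h \<le> s1" using r(3) L_nonneg by (auto simp: h_def)
  have "L * h \<le> L * (1 / (2 * L + 1))" by (intro mult_left_mono L_nonneg) (simp add: h_def)
  also have "\<dots> \<le> 1 / 2" using L_nonneg by (simp add: field_simps)
  finally have Lh: "L * h \<le> 1 / 2" .
  have "continuous_on {r..r + h} (\<lambda>s. norm (z s))"
    using r h s1 by (intro continuous_on_norm continuous_on_subset[OF z_cont]) auto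
  then obtain s2 where s2: "s2 \<in> {r..r + h}" "\<And>s. s \<in> {r..r + h} \<Longrightarrow> norm (z s) \<le> norm (z s2)"
    using continuous_attains_sup[of "{r..r + h}" "\<lambda>s. norm (z s)"] h(1) by auto
  \<comment> \<open>The derivative of \<open>z\<close> is bounded by \<open>L\<close> times the
    maximal distance \<open>norm (z s2)\<close> on the window.\<close>
  have "norm (z s2 - z r) \<le> (L * norm (z s2)) * (s2 - r)"
  proof (rule abs_continuous_on_norm_diff_le[where Z = "Z1 \<union> Z2" and y' = "\<lambda>s. f s (y1 s) (u s) - f s (y2 s) (u s)"])
    show "abs_continuous_on r s2 z" using abs_continuous_on_subinterval[OF z_ac r(1)] s2 h s1 by auto
    show "r \<le> s2" using s2 by simp
    show "0 \<le> L * norm (z s2)" using L_nonneg by simp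
    show "Z1 \<union> Z2 \<in> null_sets lebesgue" using Z1(1) Z2(1) by blast
    fix s assume s: "s \<in> {r<..<s2} - (Z1 \<union> Z2)"
    have st: "s \<in> {t<..<T}" using s r h s1 s2 by auto
    show "(z has_vector_derivative f s (y1 s) (u s) - f s (y2 s) (u s)) (at s)"
      unfolding z_def using s st by (intro has_vector_derivative_diff Z1(2) Z2(2)) auto
    have "norm (f s (y1 s) (u s) - f s (y2 s) (u s)) \<le> L * norm (y1 s - y2 s)"
      using st t u by (intro f_lipschitz) (auto simp: controls_def)
    also have "\<dots> \<le> L * norm (z s2)"
      using s2(2)[of s] s s2(1) by (intro mult_left_mono L_nonneg) (auto simp: z_def)
    finally show "norm (f s (y1 s) (u s) - f s (y2 s) (u s)) \<le> L * norm (z s2)" .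
  qed
  also have "\<dots> \<le> (L * norm (z s2)) * h" using s2(1) L_nonneg by (intro mult_left_mono) auto
  also have "\<dots> = (L * h) * norm (z s2)" by simp
  also have "\<dots> \<le> 1 / 2 * norm (z s2)" using Lh by (intro mult_right_mono) auto
  finally have "norm (z s2) \<le> 0" using r(2) by simp
  then have "z (r + h) = 0" using s2(2)[of "r + h"] h(1) by auto
  then show False using after[of "r + h"] h by auto
qed

section \<open>Existence of solutions\<close>

text \<open>Continuity of \<open>f\<close> is given only on
  \<open>{0..T} \<times> UNIV \<times> U\<close>, so the composition passes through the Borel space
  restricted to that set.\<close>

lemma vector_field_measurable:
  assumes u: "u \<in> controls t T U" and t: "0 \<le> t" and z: "continuous_on UNIV z"
  shows "(\<lambda>r. f r (z r) (u r)) \<in> borel_measurable (lebesgue_on {t..T})"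
proof -
  let ?S = "{0..T} \<times> UNIV \<times> U :: (real \<times> 'n \<times> 'm) set"
  have "(\<lambda>(s, x, u). f s x u) \<in> borel_measurable (restrict_space borel ?S)"
    by (rule borel_measurable_continuous_on_restrict[OF f_continuous])
  moreover have "(\<lambda>r. (r, z r, u r)) \<in> lebesgue_on {t..T} \<rightarrow>\<^sub>M restrict_space borel ?S"
  proof (rule measurable_restrict_space2)
    show "(\<lambda>r. (r, z r, u r)) \<in> space (lebesgue_on {t..T}) \<rightarrow> ?S"
      using u t by (auto simp: controls_def)
    have "(\<lambda>r::real. r) \<in> borel_measurable (lebesgue_on {t..T})"
      by (rule continuous_imp_measurable_on_sets_lebesgue) auto
    moreover have "z \<in> borel_measurable (lebesgue_on {t..T})"
      by (rule continuous_imp_measurable_on_sets_lebesgue) (auto intro: continuous_on_subset[OF z])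
    ultimately show "(\<lambda>r. (r, z r, u r)) \<in> borel_measurable (lebesgue_on {t..T})"
      using u by (auto simp: controls_def intro!: borel_measurable_Pair)
  qed
  ultimately have "(\<lambda>r. (\<lambda>(s, x, u). f s x u) (r, z r, u r)) \<in> borel_measurable (lebesgue_on {t..T})"
    by (rule measurable_compose[rotated])
  then show ?thesis by simp
qed

lemma vector_field_bounded:
  assumes u: "u \<in> controls t T U" and t: "0 \<le> t" and z: "continuous_on UNIV z"
  obtains B where "B > 0" "\<And>r. r \<in> {t..T} \<Longrightarrow> norm (f r (z r) (u r)) \<le> B"
proof -
  have "compact (z ` {t..T})"
    by (intro compact_continuous_image continuous_on_subset[OF z] compact_Icc) auto
  then obtain R where R: "\<forall>s\<in>{t..T}. norm (z s) \<le> R"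
    using compact_imp_bounded[of "z ` {t..T}"] by (auto simp: bounded_iff)
  obtain B where B: "B > 0" "\<And>s x u. \<lbrakk>s \<in> {0..T}; norm x \<le> R; u \<in> U\<rbrakk> \<Longrightarrow> norm (f s x u) \<le> B"
    by (rule f_bounded[of R]) (rule that)
  show thesis
  proof (rule that[OF B(1)])
    show "norm (f r (z r) (u r)) \<le> B" if "r \<in> {t..T}" for r
      using that u t R by (intro B(2)) (auto simp: controls_def)
  qed
qed

text \<open>Extension by 0 outside \<open>{t..T}\<close> makes the integrand integrable on every
  interval, the form in which \<open>integral_has_vector_derivative_ae\<close> expects it.\<close>

lemma vector_field_integrable:
  assumes u: "u \<in> controls t T U" and t: "0 \<le> t" and z: "continuous_on UNIV z"
  shows "(\<lambda>r. if r \<in> {t..T} then f r (z r) (u r) else 0) integrable_on {a..b}"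
proof -
  obtain B where B: "B > 0" "\<And>r. r \<in> {t..T} \<Longrightarrow> norm (f r (z r) (u r)) \<le> B"
    by (rule vector_field_bounded[OF u t z]) (rule that)
  let ?G = "\<lambda>r. if r \<in> {t..T} then f r (z r) (u r) else 0"
  have "(\<lambda>r. f r (z r) (u r)) absolutely_integrable_on {t..T}"
    using vector_field_measurable[OF u t z] B(2)
    by (intro measurable_bounded_by_integrable_imp_absolutely_integrable[where g = "\<lambda>_. B"]) auto
  then have "?G absolutely_integrable_on UNIV"
    using absolutely_integrable_restrict_UNIV[of "{t..T}" "\<lambda>r. f r (z r) (u r)"] by simp
  then show ?thesis
    using set_lebesgue_integral_eq_integral(1) integrable_on_subcbox[of ?G UNIV a b] by auto
qed

text \<open>Picard iteration, made a contraction by the substitution \<open>y s = exp (l * s) * w s\<close>.\<close>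
lemma integral_equation_solution:
  assumes u: "u \<in> controls t T U" and t: "0 \<le> t" "t \<le> T"
  obtains y where "continuous_on UNIV y"
    "\<And>s. s \<in> {t..T} \<Longrightarrow> y s = x + integral {t..s} (\<lambda>r. if r \<in> {t..T} then f r (y r) (u r) else 0)"
proof -
  \<comment> \<open>The contraction factor will be \<open>L / l\<close>, which is at most 1/2; the
    summand 1 keeps \<open>l\<close> positive when \<open>L = 0\<close>.\<close>
  define l where "l = 2 * L + 1"
  have "l > 0" using L_nonneg by (simp add: l_def)
  \<comment> \<open>Clamping time to \<open>{t..T}\<close> turns the Picard iterate into a bounded
    continuous function on the whole line, so that it lives in the complete space of such
    functions.\<close>
  define cl where "cl s = max t (min T s)" for s
  have cl: "cl s \<in> {t..T}" "s \<in> {t..T} \<Longrightarrow> cl s = s" for s using t by (auto simp: cl_def)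
  have cl_cont: "continuous_on UNIV cl" unfolding cl_def by (intro continuous_intros)
  define G where "G z = (\<lambda>r. if r \<in> {t..T} then f r (z r) (u r) else 0)" for z :: "real \<Rightarrow> 'n"
  define E where "E w = (\<lambda>r. exp (l * r) *\<^sub>R apply_bcontfun w r)" for w :: "real \<Rightarrow>\<^sub>C 'n"
  have E_cont: "continuous_on UNIV (E w)" for w
    unfolding E_def by (intro continuous_intros continuous_on_apply_bcontfun)
  have G_int: "G z integrable_on {a..b}" if "continuous_on UNIV z" for z a b
    unfolding G_def by (rule vector_field_integrable[OF u t(1) that])
  define P where "P w = (\<lambda>s. exp (- (l * cl s)) *\<^sub>R (x + integral {t..cl s} (G (E w))))" for w
  have P_bcontfun: "P w \<in> bcontfun" for w
  proof -
    let ?Q = "\<lambda>s. exp (- (l * s)) *\<^sub>R (x + integral {t..s} (G (E w)))"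
    have Q: "continuous_on {t..T} ?Q"
      by (intro continuous_intros indefinite_integral_continuous_1 G_int E_cont)
    have "continuous_on UNIV (\<lambda>s. ?Q (cl s))"
      using cl(1) by (intro continuous_on_compose2[OF Q cl_cont]) auto
    moreover have "bounded (?Q ` {t..T})"
      by (intro compact_imp_bounded compact_continuous_image Q compact_Icc)
    then have "bounded (range (\<lambda>s. ?Q (cl s)))"
      by (rule bounded_subset) (use cl(1) in auto)
    ultimately show ?thesis by (simp add: bcontfun_def P_def)
  qed
  have P_contraction: "dist (P w1 s) (P w2 s) \<le> 1 / 2 * dist w1 w2" for w1 w2 s
  proof -
    define D where "D = dist w1 w2"
    have "D \<ge> 0" by (simp add: D_def)
    have bound: "norm (G (E w1) r - G (E w2) r) \<le> (L * D) * exp (l * r)" if "r \<in> {t..cl s}" for r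
    proof -
      have r: "r \<in> {t..T}" "r \<in> {0..T}" "u r \<in> U" using that cl(1)[of s] t u by (auto simp: controls_def)
      have "norm (f r (E w1 r) (u r) - f r (E w2 r) (u r)) \<le> L * norm (E w1 r - E w2 r)"
        by (intro f_lipschitz r)
      also have "norm (E w1 r - E w2 r) = exp (l * r) * dist (w1 r) (w2 r)"
        by (simp add: E_def scaleR_diff_right[symmetric] dist_norm)
      also have "L * \<dots> \<le> L * (exp (l * r) * D)"
        unfolding D_def by (intro mult_left_mono dist_bounded L_nonneg) auto
      finally show ?thesis using r(1) by (simp add: G_def mult_ac)
    qed
    have t_cl: "t \<le> cl s" using cl(1)[of s] by simp
    have hi: "((\<lambda>r. (L * D) * exp (l * r)) has_integral (L * D) * ((exp (l * cl s) - exp (l * t)) / l)) {t..cl s}"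
      by (intro has_integral_mult_right has_integral_exp \<open>l > 0\<close> t_cl)
    have "norm (integral {t..cl s} (\<lambda>r. G (E w1) r - G (E w2) r)) \<le> integral {t..cl s} (\<lambda>r. (L * D) * exp (l * r))"
      using bound by (intro integral_norm_bound_integral integrable_diff G_int E_cont has_integral_integrable[OF hi])
    also have "\<dots> = (L * D) * ((exp (l * cl s) - exp (l * t)) / l)" by (rule integral_unique[OF hi])
    \<comment> \<open>The growth of the integral is exactly undone by the weight
      \<open>exp (- (l * cl s))\<close> in \<open>P\<close>, which leaves \<open>L / l\<close>
      independently of the length of the time interval.\<close>
    also have "\<dots> \<le> (L * D) * (exp (l * cl s) / l)"
      using \<open>l > 0\<close> L_nonneg \<open>D \<ge> 0\<close> by (intro mult_left_mono divide_right_mono) auto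
    finally have *: "norm (integral {t..cl s} (G (E w1)) - integral {t..cl s} (G (E w2))) \<le> (L * D) * (exp (l * cl s) / l)"
      by (simp add: Henstock_Kurzweil_Integration.integral_diff[symmetric] G_int E_cont)
    have "dist (P w1 s) (P w2 s) = exp (- (l * cl s)) * norm (integral {t..cl s} (G (E w1)) - integral {t..cl s} (G (E w2)))"
      by (simp add: P_def dist_norm scaleR_diff_right[symmetric])
    also have "\<dots> \<le> exp (- (l * cl s)) * ((L * D) * (exp (l * cl s) / l))"
      by (intro mult_left_mono * ) auto
    also have "\<dots> = (L / l) * D" by (simp add: exp_minus field_simps)
    also have "\<dots> \<le> 1 / 2 * D"
      using \<open>l > 0\<close> \<open>D \<ge> 0\<close> L_nonneg by (intro mult_right_mono) (auto simp: l_def field_simps)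
    finally show ?thesis by (simp add: D_def)
  qed
  have "\<exists>!w. Bcontfun (P w) = w"
  proof (rule banach_fix_type[of "1 / 2"])
    show "\<forall>w1 w2. dist (Bcontfun (P w1)) (Bcontfun (P w2)) \<le> 1 / 2 * dist w1 w2"
      using P_contraction by (intro allI dist_bound) (simp add: Bcontfun_inverse[OF P_bcontfun])
  qed auto
  then obtain w where w: "Bcontfun (P w) = w" by blast
  then have w': "apply_bcontfun w = P w" using Bcontfun_inverse[OF P_bcontfun, of w] by simp
  show thesis
  proof (rule that[of "E w"])
    fix s assume s: "s \<in> {t..T}"
    have "E w s = exp (l * s) *\<^sub>R P w s" using fun_cong[OF w', of s] by (simp add: E_def)
    also have "P w s = exp (- (l * s)) *\<^sub>R (x + integral {t..s} (G (E w)))"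
      by (simp add: P_def cl(2)[OF s])
    also have "exp (l * s) *\<^sub>R \<dots> = x + integral {t..s} (G (E w))" by (simp add: exp_minus)
    finally show "E w s = x + integral {t..s} (\<lambda>r. if r \<in> {t..T} then f r (E w r) (u r) else 0)"
      by (simp add: G_def)
  qed (rule E_cont)
qed

text \<open>A continuous solution of the integral equation is Lipschitz because the integrand is
  bounded, hence absolutely continuous; Lebesgue differentiation recovers the differential equation
  almost everywhere.\<close>

lemma solution_exists:
  assumes u: "u \<in> controls t T U" and t: "0 \<le> t" "t \<le> T"
  shows "\<exists>y. is_solution f t T x u y"
proof -
  obtain y where y: "continuous_on UNIV y"
    "\<And>s. s \<in> {t..T} \<Longrightarrow> y s = x + integral {t..s} (\<lambda>r. if r \<in> {t..T} then f r (y r) (u r) else 0)"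
    by (rule integral_equation_solution[OF u t, of x]) (rule that)
  define g where "g = (\<lambda>r. if r \<in> {t..T} then f r (y r) (u r) else 0)"
  have g_int: "g integrable_on {a..b}" for a b
    unfolding g_def by (rule vector_field_integrable[OF u t(1) y(1)])
  have y_eq: "y s = x + integral {t..s} g" if "s \<in> {t..T}" for s
    using y(2)[OF that] by (simp add: g_def)
  obtain B where B: "B > 0" "\<And>r. r \<in> {t..T} \<Longrightarrow> norm (f r (y r) (u r)) \<le> B"
    by (rule vector_field_bounded[OF u t(1) y(1)]) (rule that)
  have "norm (y s - y r) \<le> B * (s - r)" if rs: "t \<le> r" "r \<le> s" "s \<le> T" for r s
  proof -
    have "y s - y r = integral {r..s} g"
      using Henstock_Kurzweil_Integration.integral_combine[of t r s g] rs g_int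
      by (simp add: y_eq algebra_simps)
    moreover have "norm (integral (cbox r s) g) \<le> B * measure lborel (cbox r s)"
    proof (rule integrable_bound)
      show "g integrable_on cbox r s" using g_int by simp
      show "norm (g q) \<le> B" if "q \<in> cbox r s" for q using B that rs by (auto simp: g_def)
    qed (use B(1) in simp)
    ultimately show ?thesis using rs by simp
  qed
  then have "abs_continuous_on t T y" using B(1) by (rule abs_continuous_on_lipschitz)
  moreover have "y t = x" using y_eq[of t] t by simp
  moreover obtain N where N: "N \<in> null_sets lebesgue"
    "\<And>a s. \<lbrakk>s \<notin> N; a < s\<rbrakk> \<Longrightarrow> ((\<lambda>s. integral {a..s} g) has_vector_derivative g s) (at s)"
    by (rule integral_has_vector_derivative_ae[of g, OF g_int]) (rule that)
  have "(y has_vector_derivative f s (y s) (u s)) (at s)" if s: "s \<in> {t<..<T} - N" for s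
  proof (rule has_vector_derivative_transform_within_open)
    show "((\<lambda>s. x + integral {t..s} g) has_vector_derivative f s (y s) (u s)) (at s)"
      using has_vector_derivative_add[OF has_vector_derivative_const N(2)[of s t], of x] s by (simp add: g_def)
    show "x + integral {t..r} g = y r" if "r \<in> {t<..<T}" for r using that y_eq[of r] by simp
  qed (use s in auto)
  ultimately show ?thesis unfolding is_solution_def using N(1) by blast
qed

lemma traj_obtain_solution:
  assumes u: "u \<in> controls t T U" and t: "0 \<le> t" "t \<le> T"
  obtains y where "is_solution f t T x u y" "traj f T t x u T = y T"
proof -
  obtain y where y: "is_solution f t T x u y" using solution_exists[OF assms] by blast
  have "traj f T t x u T = y T" unfolding traj_def
  proof (rule the_equality)
    show "z = y T" if "\<exists>y. is_solution f t T x u y \<and> y T = z" for z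
      using that solution_unique[OF u t(1) _ y, of _ T] t by auto
  qed (use y in blast)
  then show thesis using that y by blast
qed

section \<open>Estimates for the Hamiltonian\<close>

text \<open>A real \<open>Sup\<close> dominates its set only if that set is bounded above; this
  follows here from the bound on \<open>f\<close> over the compact \<open>U\<close>.\<close>

lemma hamiltonian_upper:
  assumes s: "s \<in> {0..T}" and "u \<in> U"
  shows "(- p) \<bullet> f s x u \<le> hamiltonian f U s x p"
proof -
  obtain B where B: "\<And>u. u \<in> U \<Longrightarrow> norm (f s x u) \<le> B"
    using f_bounded[of "norm x"] s by (metis order_refl)
  have "(- p) \<bullet> f s x u \<le> norm (- p) * B" if "u \<in> U" for u
    by (rule order_trans[OF norm_cauchy_schwarz]) (intro mult_left_mono B that norm_ge_zero)
  then show ?thesis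
    unfolding hamiltonian_def using assms(2) by (intro cSUP_upper bdd_aboveI2)
qed

lemma hamiltonian_lipschitz:
  assumes s: "s \<in> {0..T}"
  shows "hamiltonian f U s y p \<le> hamiltonian f U s x p + norm p * (L * norm (x - y))"
  unfolding hamiltonian_def[of _ _ _ y]
proof (rule cSUP_least[OF U_nonempty])
  fix u assume u: "u \<in> U"
  have "(- p) \<bullet> f s y u = (- p) \<bullet> f s x u + p \<bullet> (f s x u - f s y u)" by (simp add: inner_diff_right)
  also have "\<dots> \<le> hamiltonian f U s x p + norm p * norm (f s x u - f s y u)"
    by (intro add_mono hamiltonian_upper s u norm_cauchy_schwarz)
  also have "\<dots> \<le> hamiltonian f U s x p + norm p * (L * norm (x - y))"
    by (intro add_left_mono mult_left_mono f_lipschitz s u norm_ge_zero)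
  finally show "(- p) \<bullet> f s y u \<le> hamiltonian f U s x p + norm p * (L * norm (x - y))" .
qed

text \<open>An average of velocities need not be a velocity \<open>f s z u\<close> itself. But each
  velocity, whatever the control value, obeys the same bound after pairing with \<open>- q\<close>,
  and the mean value inequality transfers this bound to the increment of \<open>y\<close>. The error
  \<open>\<eta>\<close> pays for freezing time and state at \<open>(s, z)\<close>.\<close>

lemma solution_increment_le_hamiltonian:
  assumes u: "u \<in> controls t T U" and t: "0 \<le> t" and y: "is_solution f t T x u y"
    and s: "t \<le> s" "0 < h" "s + h \<le> T"
    and near: "\<And>r u. \<lbrakk>r \<in> {s..s + h}; u \<in> U\<rbrakk> \<Longrightarrow> norm (f r (y r) u - f s z u) \<le> \<eta>"
  shows "- (q \<bullet> (y (s + h) - y s)) \<le> (hamiltonian f U s z q + norm q * \<eta>) * h"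
proof -
  obtain Z where Z: "Z \<in> null_sets lebesgue"
    "\<And>s. s \<in> {t<..<T} - Z \<Longrightarrow> (y has_vector_derivative f s (y s) (u s)) (at s)"
    using y by (auto simp: is_solution_def)
  have "(- q) \<bullet> y (s + h) - (- q) \<bullet> y s \<le> (hamiltonian f U s z q + norm q * \<eta>) * (s + h - s)"
  proof (rule abs_continuous_on_diff_le[OF _ _ Z(1)])
    show "abs_continuous_on s (s + h) (\<lambda>s. (- q) \<bullet> y s)"
    proof (rule abs_continuous_on_bounded_linear[OF _ bounded_linear_inner_right])
      show "abs_continuous_on s (s + h) y"
        using abs_continuous_on_subinterval[of t T y s "s + h"] y s by (simp add: is_solution_def)
    qed
    fix r assume r: "r \<in> {s<..<s + h} - Z"
    show "((\<lambda>s. (- q) \<bullet> y s) has_real_derivative (- q) \<bullet> f r (y r) (u r)) (at r)"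
      using bounded_linear.has_vector_derivative[OF bounded_linear_inner_right Z(2)[of r], of "- q"] r s
      by (simp add: has_real_derivative_iff_has_vector_derivative)
    have ur: "u r \<in> U" using r s u by (auto simp: controls_def)
    have "(- q) \<bullet> f r (y r) (u r) = (- q) \<bullet> f s z (u r) + (- q) \<bullet> (f r (y r) (u r) - f s z (u r))"
      by (simp add: inner_diff_right)
    also have "\<dots> \<le> hamiltonian f U s z q + norm (- q) * norm (f r (y r) (u r) - f s z (u r))"
      using s t by (intro add_mono hamiltonian_upper ur norm_cauchy_schwarz) auto
    also have "\<dots> \<le> hamiltonian f U s z q + norm (- q) * \<eta>"
      using r by (intro add_left_mono mult_left_mono near ur norm_ge_zero) auto
    finally show "(- q) \<bullet> f r (y r) (u r) \<le> hamiltonian f U s z q + norm q * \<eta>" by simp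
  qed (use s in simp)
  then show ?thesis by (simp add: inner_diff_right)
qed

section \<open>The subsolution inequality along a smooth curve\<close>

text \<open>The maximum of \<open>v s x - k * norm (x - Y s)^2 - \<psi> s\<close> over a tube around the curve \<open>Y\<close> is
  attained in the interior of the tube, where the subsolution inequality bounds \<open>- \<psi>'\<close> from above.\<close>
lemma subsolution_along_curve:
  fixes v :: "real \<Rightarrow> 'n \<Rightarrow> real" and Y Y' :: "real \<Rightarrow> 'n" and w \<psi> \<psi>' :: "real \<Rightarrow> real"
  assumes ac: "0 < a" "c < T"
    and sub: "visc_subsolution f U {(t, x). t \<in> {0<..<T} \<and> v t x > 0} v"
    and v_cont: "continuous_on ({0..T} \<times> UNIV) (\<lambda>(t, x). v t x)"
    and Y: "\<And>s. s \<in> {0<..<T} \<Longrightarrow> (Y has_vector_derivative Y' s) (at s)"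
    and Y': "continuous_on {0<..<T} Y'"
    and \<psi>: "\<And>s. (\<psi> has_real_derivative \<psi>' s) (at s)" and \<psi>': "continuous_on UNIV \<psi>'"
    and "\<sigma> > 0" "m > 0"
    and tube: "\<And>s x. \<lbrakk>s \<in> {a..c}; norm (x - Y s) \<le> \<sigma>\<rbrakk> \<Longrightarrow> \<bar>v s x - w s\<bar> \<le> m \<and> v s x > 0"
    and s1: "s1 \<in> {a<..<c}" "w a - \<psi> a + 2 * m < w s1 - \<psi> s1" "w c - \<psi> c + 2 * m < w s1 - \<psi> s1"
    and Y'_le: "\<And>s q. s \<in> {a<..<c} \<Longrightarrow> - (q \<bullet> Y' s) \<le> hamiltonian f U s (Y s) q + norm q * \<eta>"
    and "0 \<le> \<eta>"
  shows "\<exists>s\<in>{a<..<c}. - \<psi>' s \<le> 4 * L * m + 8 * m * \<eta> / \<sigma>"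
proof -
  \<comment> \<open>With this \<open>k\<close> the penalty equals \<open>4 * m\<close> on the
    lateral boundary \<open>norm z = \<sigma>\<close>, while at the maximum it can be at most
    \<open>2 * m\<close>.\<close>
  define k where "k = 4 * m / \<sigma>\<^sup>2"
  have "k > 0" using \<open>\<sigma> > 0\<close> \<open>m > 0\<close> by (simp add: k_def)
  define \<xi> where "\<xi> = (\<lambda>(s, x). k * ((x - Y s) \<bullet> (x - Y s)) + \<psi> s)"
  define \<xi>t where "\<xi>t = (\<lambda>(s, x). - 2 * k * ((x - Y s) \<bullet> Y' s) + \<psi>' s)"
  define \<xi>x where "\<xi>x = (\<lambda>(s, x). (2 * k) *\<^sub>R (x - Y s))"
  let ?\<Omega> = "{(t, x). t \<in> {0<..<T} \<and> v t x > 0}"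
  have Y_cont: "continuous_on {0<..<T} Y"
    by (intro continuous_at_imp_continuous_on ballI has_vector_derivative_continuous[OF Y])
  have \<psi>_cont: "continuous_on A \<psi>" for A
    by (intro continuous_at_imp_continuous_on ballI DERIV_isCont[OF \<psi>])
  have Y_fst: "continuous_on A (\<lambda>z::real \<times> 'n. Y (fst z))" if "fst ` A \<subseteq> {0<..<T}" for A
    by (rule continuous_on_compose2[OF Y_cont continuous_on_fst[OF continuous_on_id] that])
  have Y'_fst: "continuous_on A (\<lambda>z::real \<times> 'n. Y' (fst z))" if "fst ` A \<subseteq> {0<..<T}" for A
    by (rule continuous_on_compose2[OF Y' continuous_on_fst[OF continuous_on_id] that])
  have \<psi>_fst: "continuous_on A (\<lambda>z::real \<times> 'n. \<psi> (fst z))" for A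
    by (rule continuous_on_compose2[OF \<psi>_cont[of UNIV] continuous_on_fst[OF continuous_on_id]]) simp
  have \<psi>'_fst: "continuous_on A (\<lambda>z::real \<times> 'n. \<psi>' (fst z))" for A
    by (rule continuous_on_compose2[OF \<psi>' continuous_on_fst[OF continuous_on_id]]) simp
  \<comment> \<open>In the coordinates \<open>z = x - Y s\<close> the tube becomes the compact
    product \<open>{a..c} \<times> cball 0 \<sigma>\<close>.\<close>
  define \<Phi> where "\<Phi> = (\<lambda>p::real \<times> 'n. v (fst p) (Y (fst p) + snd p) - k * (snd p \<bullet> snd p) - \<psi> (fst p))"
  have sub_ac: "fst ` ({a..c} \<times> cball 0 \<sigma>) \<subseteq> {0<..<T}" using ac by auto
  have "continuous_on ({a..c} \<times> cball 0 \<sigma>) (\<lambda>p. (\<lambda>(t, x). v t x) (fst p, Y (fst p) + snd p))"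
    using ac by (intro continuous_on_compose2[OF v_cont] continuous_intros Y_fst[OF sub_ac]) auto
  then have "continuous_on ({a..c} \<times> cball 0 \<sigma>) \<Phi>"
    unfolding \<Phi>_def by (intro continuous_intros \<psi>_fst) auto
  moreover have "compact ({a..c} \<times> cball (0::'n) \<sigma>)" by (intro compact_Times compact_Icc compact_cball)
  moreover have s1_in: "(s1, 0) \<in> {a..c} \<times> cball (0::'n) \<sigma>" using s1(1) \<open>\<sigma> > 0\<close> by auto
  ultimately obtain p where p: "p \<in> {a..c} \<times> cball 0 \<sigma>" "\<And>p'. p' \<in> {a..c} \<times> cball 0 \<sigma> \<Longrightarrow> \<Phi> p' \<le> \<Phi> p"
    using continuous_attains_sup[of "{a..c} \<times> cball 0 \<sigma>" \<Phi>] by blast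
  obtain s0 z0 where p_eq: "p = (s0, z0)" by (cases p)
  have s0: "s0 \<in> {a..c}" and z0: "norm z0 \<le> \<sigma>" using p(1) by (auto simp: p_eq)
  have max: "v s (Y s + z) - k * (z \<bullet> z) - \<psi> s \<le> v s0 (Y s0 + z0) - k * (z0 \<bullet> z0) - \<psi> s0"
    if "s \<in> {a..c}" "norm z \<le> \<sigma>" for s z
    using p(2)[of "(s, z)"] that by (simp add: \<Phi>_def p_eq)
  have tube': "\<bar>v s (Y s + z) - w s\<bar> \<le> m" if "s \<in> {a..c}" "norm z \<le> \<sigma>" for s z
    using tube[of s "Y s + z"] that by simp
  have "k * (z0 \<bullet> z0) \<ge> 0" using \<open>k > 0\<close> by simp
  \<comment> \<open>Comparison with the central point \<open>(s1, 0)\<close>: replacing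
    \<open>v\<close> by \<open>w\<close> costs \<open>m\<close> at each of the two points, and the
    assumed gaps of more than \<open>2 * m\<close> exclude both time ends.\<close>
  then have "w s1 - \<psi> s1 \<le> w s0 - \<psi> s0 + 2 * m"
    using max[of s1 0] tube'[of s1 0] tube'[OF s0 z0] s1(1) \<open>\<sigma> > 0\<close> by (simp add: abs_le_iff)
  then have "s0 \<noteq> a" "s0 \<noteq> c" using s1(2,3) by auto
  then have s0': "s0 \<in> {a<..<c}" "s0 \<in> {0<..<T}" "s0 \<in> {0..T}" using s0 ac by auto
  \<comment> \<open>Comparison with the central point at the same time, \<open>(s0, 0)\<close>,
    where the penalty vanishes.\<close>
  have kz: "k * (z0 \<bullet> z0) \<le> 2 * m"
    using max[of s0 0] tube'[of s0 0] tube'[OF s0 z0] s0 \<open>\<sigma> > 0\<close> by (simp add: abs_le_iff)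
  have z0_less: "norm z0 < \<sigma>"
  proof (rule ccontr)
    assume "\<not> norm z0 < \<sigma>"
    then have "norm z0 = \<sigma>" using z0 by simp
    then have "k * (z0 \<bullet> z0) = 4 * m" using \<open>\<sigma> > 0\<close> by (simp add: k_def power2_norm_eq_inner[symmetric])
    then show False using kz \<open>m > 0\<close> by simp
  qed
  define x0 where "x0 = Y s0 + z0"
  define q where "q = (2 * k) *\<^sub>R z0"
  have "- \<xi>t (s0, x0) + hamiltonian f U s0 x0 (\<xi>x (s0, x0)) \<le> 0"
  proof (rule sub[unfolded visc_subsolution_def, rule_format], intro conjI ballI)
    have fst\<Omega>: "fst ` ?\<Omega> \<subseteq> {0<..<T}" by auto
    show "continuous_on ?\<Omega> \<xi>t"
      unfolding \<xi>t_def[unfolded case_prod_beta'] by (intro continuous_intros Y_fst Y'_fst \<psi>'_fst fst\<Omega>)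
    show "continuous_on ?\<Omega> \<xi>x"
      unfolding \<xi>x_def[unfolded case_prod_beta'] by (intro continuous_intros Y_fst fst\<Omega>)
    show "(\<xi> has_derivative (\<lambda>(h, k). \<xi>t z * h + \<xi>x z \<bullet> k)) (at z)" if "z \<in> ?\<Omega>" for z
    proof -
      have "fst z \<in> {0<..<T}" using that by auto
      have dY: "((\<lambda>z. Y (fst z)) has_derivative (\<lambda>hk. fst hk *\<^sub>R Y' (fst z))) (at z)"
        using has_derivative_compose[OF has_derivative_fst[OF has_derivative_ident]
            Y[OF \<open>fst z \<in> _\<close>, unfolded has_vector_derivative_def]] by simp
      have d\<psi>: "((\<lambda>z. \<psi> (fst z)) has_derivative (\<lambda>hk. \<psi>' (fst z) * fst hk)) (at z)"
        using has_derivative_compose[OF has_derivative_fst[OF has_derivative_ident]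
            \<psi>[of "fst z", unfolded has_field_derivative_def]] by simp
      show ?thesis
        unfolding \<xi>_def \<xi>t_def \<xi>x_def case_prod_beta'
        by (rule has_derivative_eq_rhs, (rule derivative_intros dY d\<psi>)+)
          (simp add: fun_eq_iff inner_diff_right inner_diff_left inner_commute algebra_simps)
    qed
    show "(s0, x0) \<in> ?\<Omega>" using s0' tube[OF s0, of x0] z0 by (simp add: x0_def)
    \<comment> \<open>In the open tube the maximum over the closed tube is a local maximum of
      \<open>v - \<xi>\<close> at \<open>(s0, x0)\<close>.\<close>
    let ?N = "{z \<in> {a<..<c} \<times> UNIV. norm (snd z - Y (fst z)) < \<sigma>}"
    have "open ?N"
    proof -
      have "continuous_on ({a<..<c} \<times> UNIV) (\<lambda>z. norm (snd z - Y (fst z)))"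
        using ac by (intro continuous_intros Y_fst) auto
      then have "open (({a<..<c} \<times> UNIV) \<inter> (\<lambda>z. norm (snd z - Y (fst z))) -` {..<\<sigma>})"
        by (rule continuous_open_preimage) (auto intro: open_Times)
      also have "({a<..<c} \<times> UNIV) \<inter> (\<lambda>z. norm (snd z - Y (fst z))) -` {..<\<sigma>} = ?N" by auto
      finally show ?thesis .
    qed
    moreover have "(s0, x0) \<in> ?N" using s0' z0_less by (simp add: x0_def)
    ultimately obtain e where "e > 0" and e: "ball (s0, x0) e \<subseteq> ?N" by (rule openE)
    have "v (fst z) (snd z) - \<xi> z \<le> v s0 x0 - \<xi> (s0, x0)" if "z \<in> ball (s0, x0) e \<inter> ?\<Omega>" for z
    proof -
      have "z \<in> ?N" using that e by blast
      then show ?thesis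
        using max[of "fst z" "snd z - Y (fst z)"] by (simp add: \<xi>_def case_prod_beta x0_def mem_Times_iff)
    qed
    then show "\<exists>e>0. \<forall>z\<in>ball (s0, x0) e \<inter> ?\<Omega>. v (fst z) (snd z) - \<xi> z \<le> v s0 x0 - \<xi> (s0, x0)"
      using \<open>e > 0\<close> by blast
  qed
  then have "q \<bullet> Y' s0 - \<psi>' s0 + hamiltonian f U s0 x0 q \<le> 0"
    by (simp add: \<xi>t_def \<xi>x_def x0_def q_def)
  moreover have "hamiltonian f U s0 (Y s0) q \<le> hamiltonian f U s0 x0 q + norm q * (L * norm z0)"
    using hamiltonian_lipschitz[OF s0'(3), of "Y s0" q x0] by (simp add: x0_def)
  \<comment> \<open>Since \<open>q\<close> is proportional to \<open>z0\<close>, the product is a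
    multiple of the penalty, and the bound \<open>kz\<close> makes it independent of
    \<open>\<sigma>\<close>.\<close>
  moreover have "norm q * (L * norm z0) \<le> 4 * L * m"
  proof -
    have "norm q * (L * norm z0) = (2 * L) * (k * (z0 \<bullet> z0))"
      using \<open>k > 0\<close> by (simp add: q_def power2_norm_eq_inner[symmetric] power2_eq_square)
    also have "\<dots> \<le> (2 * L) * (2 * m)" using kz L_nonneg by (intro mult_left_mono) auto
    finally show ?thesis by simp
  qed
  moreover have "norm q * \<eta> \<le> 8 * m * \<eta> / \<sigma>"
  proof -
    have "norm q \<le> 2 * k * \<sigma>" using z0 \<open>k > 0\<close> by (simp add: q_def)
    also have "\<dots> = 8 * m / \<sigma>" using \<open>\<sigma> > 0\<close> by (simp add: k_def power2_eq_square)
    finally have "norm q * \<eta> \<le> (8 * m / \<sigma>) * \<eta>" using \<open>0 \<le> \<eta>\<close> by (rule mult_right_mono)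
    then show ?thesis by simp
  qed
  \<comment> \<open>Inserting \<open>Y'_le\<close> cancels \<open>q \<bullet> Y' s0\<close> against
    the Hamiltonian on the curve; only the two error terms remain.\<close>
  ultimately have "- \<psi>' s0 \<le> 4 * L * m + 8 * m * \<eta> / \<sigma>"
    using Y'_le[OF s0'(1), of q] by linarith
  then show ?thesis using s0'(1) by blast
qed

section \<open>Smoothing of solutions and moduli of continuity\<close>

text \<open>A solution is only differentiable almost everywhere, so its graph cannot carry a \<open>C\<^sup>1\<close> test
  function; it is replaced by its forward averages over a short window \<open>h\<close>.\<close>
lemma forward_average:
  fixes y :: "real \<Rightarrow> 'n"
  assumes "B > 0" and lip: "\<And>r s. \<lbrakk>t \<le> r; r \<le> s; s \<le> T\<rbrakk> \<Longrightarrow> norm (y s - y r) \<le> B * (s - r)"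
    and t: "0 \<le> t" "t \<le> T" and h: "h > 0"
  obtains Y Y' where "\<And>s. s \<in> {0<..<T} \<Longrightarrow> (Y has_vector_derivative Y' s) (at s)"
    "continuous_on {0<..<T} Y'"
    "\<And>s. \<lbrakk>t \<le> s; s + h \<le> T\<rbrakk> \<Longrightarrow> Y' s = (y (s + h) - y s) /\<^sub>R h"
    "\<And>s r. \<lbrakk>t \<le> s; s + h \<le> T; r \<in> {s..s + h}\<rbrakk> \<Longrightarrow> norm (Y s - y r) \<le> B * h"
proof -
  \<comment> \<open>The test function must be \<open>C\<^sup>1\<close> over all times in
    \<open>{0<..<T}\<close>, so \<open>y\<close> is continued by its end values outside
    \<open>{t..T}\<close>.\<close>
  define yc where "yc s = y (max t (min T s))" for s
  have yc: "yc s = y s" if "s \<in> {t..T}" for s using that by (auto simp: yc_def)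
  have "continuous_on {t..T} y"
    by (rule abs_continuous_on_imp_continuous_on[OF abs_continuous_on_lipschitz[OF lip \<open>B > 0\<close>]])
  then have yc_cont: "continuous_on UNIV yc"
    unfolding yc_def by (rule continuous_on_compose2) (use t in \<open>auto intro!: continuous_intros\<close>)
  then have yc_cont': "continuous_on A yc" for A by (rule continuous_on_subset) simp
  \<comment> \<open>The base point -1 lies strictly to the left of all times used, so
    \<open>F\<close> has a two-sided derivative at each of them.\<close>
  define F where "F s = integral {-1..s} yc" for s
  have F: "(F has_vector_derivative yc s) (at s)" if "s > -1" for s
  proof -
    have "(F has_vector_derivative yc s) (at s within {-1..s + 1})"
      unfolding F_def using that by (intro integral_has_vector_derivative yc_cont') auto
    then show ?thesis using that by (simp add: at_within_Icc_at)
  qed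
  define Y where "Y s = (F (s + h) - F s) /\<^sub>R h" for s
  show thesis
  proof (rule that)
    fix s assume "s \<in> {0<..<T}"
    have "((\<lambda>s. s + h) has_real_derivative 1) (at s)" by (auto intro!: derivative_eq_intros)
    then have "((\<lambda>s. F (s + h)) has_vector_derivative yc (s + h)) (at s)"
      using vector_diff_chain_at[of "\<lambda>s. s + h" 1 s F "yc (s + h)"] F[of "s + h"] \<open>s \<in> _\<close> h
      by (auto simp: o_def has_real_derivative_iff_has_vector_derivative)
    then show "(Y has_vector_derivative (yc (s + h) - yc s) /\<^sub>R h) (at s)"
      unfolding Y_def using F[of s] \<open>s \<in> _\<close>
      by (intro bounded_linear.has_vector_derivative[OF bounded_linear_scaleR_right] has_vector_derivative_diff) auto
  next
    show "continuous_on {0<..<T} (\<lambda>s. (yc (s + h) - yc s) /\<^sub>R h)"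
      by (intro continuous_intros continuous_on_compose2[OF yc_cont] yc_cont') auto
  next
    fix s assume "t \<le> s" "s + h \<le> T"
    then show "(yc (s + h) - yc s) /\<^sub>R h = (y (s + h) - y s) /\<^sub>R h" using h by (simp add: yc)
  next
    fix s r assume s: "t \<le> s" "s + h \<le> T" and r: "r \<in> {s..s + h}"
    have "F (s + h) = F s + integral {s..s + h} yc"
      unfolding F_def using s t h
      by (intro Henstock_Kurzweil_Integration.integral_combine[symmetric] integrable_continuous_real yc_cont') auto
    then have "h *\<^sub>R (Y s - y r) = integral {s..s + h} yc - h *\<^sub>R y r"
      using h by (simp add: Y_def scaleR_diff_right)
    also have "\<dots> = integral {s..s + h} (\<lambda>q. yc q - y r)"
      using h by (subst Henstock_Kurzweil_Integration.integral_diff)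
        (auto intro: integrable_continuous_real yc_cont')
    finally have "norm (h *\<^sub>R (Y s - y r)) = norm (integral {s..s + h} (\<lambda>q. yc q - y r))" by simp
    also have "\<dots> \<le> (B * h) * (s + h - s)"
    proof (rule integral_bound)
      show "continuous_on {s..s + h} (\<lambda>q. yc q - y r)" by (intro continuous_intros yc_cont')
      fix q assume q: "q \<in> {s..s + h}"
      have "norm (y q - y r) \<le> B * \<bar>q - r\<bar>"
        using lip[of r q] lip[of q r] q r s by (cases "r \<le> q") (auto simp: norm_minus_commute)
      also have "\<dots> \<le> B * h" using q r \<open>B > 0\<close> by (intro mult_left_mono) auto
      finally show "norm (yc q - y r) \<le> B * h" using q s by (simp add: yc)
    qed (use h in simp)
    finally have "h * norm (Y s - y r) \<le> h * (B * h)" using h by (simp add: mult_ac)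
    then show "norm (Y s - y r) \<le> B * h" using h by simp
  qed
qed

lemma tube_modulus:
  fixes v :: "real \<Rightarrow> 'n \<Rightarrow> real"
  assumes "0 \<le> a" "c \<le> T" and v_cont: "continuous_on ({0..T} \<times> UNIV) (\<lambda>(t, x). v t x)"
    and y: "continuous_on {a..c} y" and "m > 0"
  obtains d where "d > 0" "\<And>s x. \<lbrakk>s \<in> {a..c}; norm (x - y s) \<le> d\<rbrakk> \<Longrightarrow> \<bar>v s x - v s (y s)\<bar> \<le> m"
proof -
  have "compact (y ` {a..c})" by (intro compact_continuous_image y compact_Icc)
  then obtain R where R: "\<forall>s\<in>{a..c}. norm (y s) \<le> R"
    using compact_imp_bounded[of "y ` {a..c}"] by (auto simp: bounded_iff)
  have "uniformly_continuous_on ({a..c} \<times> cball 0 (R + 1)) (\<lambda>(t, x). v t x)"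
    using assms(1,2) by (intro compact_uniformly_continuous compact_Times compact_Icc compact_cball
        continuous_on_subset[OF v_cont]) auto
  then obtain d where "d > 0" and d: "\<And>p p'. \<lbrakk>p \<in> {a..c} \<times> cball 0 (R + 1); p' \<in> {a..c} \<times> cball 0 (R + 1);
      dist p' p < d\<rbrakk> \<Longrightarrow> dist ((\<lambda>(t, x). v t x) p') ((\<lambda>(t, x). v t x) p) < m"
    using \<open>m > 0\<close> unfolding uniformly_continuous_on_def by metis
  show thesis
  proof (rule that)
    \<comment> \<open>The entry 1 keeps \<open>x\<close> in the ball of radius \<open>R + 1\<close>,
      where uniform continuity holds; \<open>d / 2\<close> turns a weak inequality into the strict
      one required.\<close>
    show "min (d / 2) 1 > 0" using \<open>d > 0\<close> by simp
    fix s x assume s: "s \<in> {a..c}" and x: "norm (x - y s) \<le> min (d / 2) 1"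
    have "norm x \<le> norm (x - y s) + norm (y s)" using norm_triangle_ineq[of "x - y s" "y s"] by simp
    then have "norm x \<le> R + 1" "norm (y s) \<le> R + 1" using x R s by force+
    moreover have "dist (s, x) (s, y s) < d" using x \<open>d > 0\<close> by (simp add: dist_Pair_Pair dist_norm)
    ultimately show "\<bar>v s x - v s (y s)\<bar> \<le> m" using d[of "(s, y s)" "(s, x)"] s by (simp add: dist_real_def)
  qed
qed

lemma f_modulus:
  assumes "\<eta> > 0"
  obtains d where "d > 0" "\<And>r s x z u. \<lbrakk>r \<in> {0..T}; s \<in> {0..T}; norm x \<le> R; norm z \<le> R; u \<in> U;
      \<bar>r - s\<bar> \<le> d; norm (x - z) \<le> d\<rbrakk> \<Longrightarrow> norm (f r x u - f s z u) \<le> \<eta>"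
proof -
  let ?K = "{0..T} \<times> cball 0 R \<times> U"
  have "uniformly_continuous_on ?K (\<lambda>(s, x, u). f s x u)"
    by (intro compact_uniformly_continuous compact_Times compact_Icc compact_cball U_compact
        continuous_on_subset[OF f_continuous]) auto
  then obtain d where "d > 0" and d: "\<And>p p'. \<lbrakk>p \<in> ?K; p' \<in> ?K; dist p' p < d\<rbrakk>
      \<Longrightarrow> dist ((\<lambda>(s, x, u). f s x u) p') ((\<lambda>(s, x, u). f s x u) p) < \<eta>"
    using \<open>\<eta> > 0\<close> unfolding uniformly_continuous_on_def by metis
  show thesis
  proof (rule that)
    \<comment> \<open>The displacements in time and in state together stay below
      \<open>d\<close>.\<close>
    show "d / 3 > 0" using \<open>d > 0\<close> by simp
    fix r s u and x z :: 'n assume *: "r \<in> {0..T}" "s \<in> {0..T}" "norm x \<le> R" "norm z \<le> R" "u \<in> U"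
      "\<bar>r - s\<bar> \<le> d / 3" "norm (x - z) \<le> d / 3"
    have "dist (r, x, u) (s, z, u) \<le> dist r s + dist x z"
      using sqrt_sum_squares_le_sum_abs[of "dist r s" "dist x z"] by (simp add: dist_Pair_Pair)
    also have "\<dots> < d" using * \<open>d > 0\<close> by (simp add: dist_norm)
    finally show "norm (f r x u - f s z u) \<le> \<eta>"
      using d[of "(s, z, u)" "(r, x, u)"] * by (simp add: dist_norm)
  qed
qed

section \<open>Monotonicity along solutions and the conclusion\<close>

text \<open>The bounds \<open>0 < a\<close> and \<open>c < T\<close> keep the tube inside the open
  time interval and leave room for the averaging window to the right of \<open>c\<close>. The
  contradiction compares \<open>\<kappa>\<close>, a lower bound for \<open>- \<psi>'\<close>, with
  errors of total size at most \<open>3 * \<kappa> / 4\<close>.\<close>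

lemma subsolution_nondecreasing:
  fixes v :: "real \<Rightarrow> 'n \<Rightarrow> real"
  assumes u: "u \<in> controls t T U" and t: "0 \<le> t" and y: "is_solution f t T x u y"
    and ac: "t \<le> a" "0 < a" "a \<le> c" "c < T"
    and sub: "visc_subsolution f U {(t, x). t \<in> {0<..<T} \<and> v t x > 0} v"
    and v_cont: "continuous_on ({0..T} \<times> UNIV) (\<lambda>(t, x). v t x)"
    and pos: "\<And>s. s \<in> {a..c} \<Longrightarrow> v s (y s) > 0"
  shows "v a (y a) \<le> v c (y c)"
proof (rule ccontr)
  assume "\<not> v a (y a) \<le> v c (y c)"
  define w where "w s = v s (y s)" for s
  \<comment> \<open>A third of the supposed drop: up to \<open>s1\<close> the function
    \<open>w\<close> loses at most \<open>\<delta>\<close>, and \<open>\<psi> s1\<close> costs at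
    most \<open>\<delta> / 2\<close>. So \<open>w - \<psi>\<close> at \<open>s1\<close> exceeds its
    value at \<open>a\<close> by at least \<open>\<delta> / 2\<close> and its value at
    \<open>c\<close> by more than that.\<close>
  define \<delta> where "\<delta> = (w a - w c) / 3"
  have "\<delta> > 0" using \<open>\<not> _\<close> by (simp add: \<delta>_def w_def)
  have "a < c" using \<open>\<not> _\<close> ac by (cases "a = c") auto
  obtain B where B: "B > 0" "\<And>r s. \<lbrakk>t \<le> r; r \<le> s; s \<le> T\<rbrakk> \<Longrightarrow> norm (y s - y r) \<le> B * (s - r)"
    by (rule solution_lipschitz[OF u t y]) (rule that)
  have y_cont: "continuous_on {t..T} y"
    using y abs_continuous_on_imp_continuous_on by (auto simp: is_solution_def)
  have y_cont': "continuous_on {a..c} y" using ac by (intro continuous_on_subset[OF y_cont]) auto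
  have "continuous_on {a..c} (\<lambda>s. (\<lambda>(t, x). v t x) (s, y s))"
    using ac by (intro continuous_on_compose2[OF v_cont] continuous_intros y_cont') auto
  then have w_cont: "continuous_on {a..c} w" by (simp add: w_def[abs_def])
  \<comment> \<open>The minimum of \<open>w\<close> is a uniform positive margin: an oscillation
    \<open>m\<close> below it keeps \<open>v\<close> positive in the whole tube.\<close>
  obtain s2 where s2: "s2 \<in> {a..c}" "\<And>s. s \<in> {a..c} \<Longrightarrow> w s2 \<le> w s"
    using continuous_attains_inf[OF compact_Icc _ w_cont] \<open>a < c\<close> by auto
  have "w s2 > 0" using pos s2(1) by (simp add: w_def)
  obtain d1 where "d1 > 0" and d1: "\<And>s. \<lbrakk>s \<in> {a..c}; dist s a < d1\<rbrakk> \<Longrightarrow> dist (w s) (w a) < \<delta>"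
    using w_cont \<open>\<delta> > 0\<close> \<open>a < c\<close> unfolding continuous_on_iff by (meson atLeastAtMost_iff less_imp_le order_refl)
  define s1 where "s1 = a + min d1 (c - a) / 2"
  have s1: "s1 \<in> {a<..<c}" "dist s1 a < d1" 
  proof -
    define e where "e = min d1 (c - a)"
    have "0 < e" "e \<le> d1" "e \<le> c - a" using \<open>d1 > 0\<close> \<open>a < c\<close> by (auto simp: e_def)
    then show "s1 \<in> {a<..<c}" "dist s1 a < d1" by (auto simp: s1_def e_def[symmetric] dist_real_def)
  qed
  have w_s1: "w s1 \<ge> w a - \<delta>" using d1[of s1] s1 by (simp add: dist_real_def)
  \<comment> \<open>The rate makes \<open>\<psi>\<close> fall from \<open>2 * \<delta>\<close> at
    \<open>a\<close> to \<open>2 * \<delta> * exp (- 4)\<close> at \<open>s1\<close>, which is at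
    most \<open>\<delta> / 2\<close>.\<close>
  define l where "l = 4 / (s1 - a)"
  have "l > 0" using s1 by (simp add: l_def)
  define \<psi> where "\<psi> s = 2 * \<delta> * exp (- (l * (s - a)))" for s
  define \<psi>' where "\<psi>' s = - (l * \<psi> s)" for s
  have \<psi>_deriv: "(\<psi> has_real_derivative \<psi>' s) (at s)" for s
    unfolding \<psi>_def \<psi>'_def by (auto intro!: derivative_eq_intros)
  have \<psi>'_cont: "continuous_on UNIV \<psi>'" unfolding \<psi>'_def \<psi>_def by (intro continuous_intros)
  have \<psi>_s1: "\<psi> s1 \<le> \<delta> / 2"
  proof -
    have "exp (4::real) \<ge> 4" using exp_ge_add_one_self[of "4::real"] by simp
    then have "exp (- 4 :: real) \<le> 1 / 4" by (simp add: exp_minus field_simps)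
    moreover have "l * (s1 - a) = 4" unfolding l_def using s1(1) by (intro nonzero_eq_divide_eq[THEN iffD1]) auto
    ultimately show ?thesis using \<open>\<delta> > 0\<close> by (simp add: \<psi>_def)
  qed
  have \<psi>_pos: "\<psi> s > 0" for s using \<open>\<delta> > 0\<close> by (simp add: \<psi>_def)
  define \<kappa> where "\<kappa> = l * \<psi> c"
  have "\<kappa> > 0" using \<open>l > 0\<close> \<psi>_pos by (simp add: \<kappa>_def)
  have \<psi>'_le: "\<kappa> \<le> - \<psi>' s" if "s \<in> {a<..<c}" for s
    using that \<open>l > 0\<close> \<open>\<delta> > 0\<close> by (simp add: \<kappa>_def \<psi>'_def \<psi>_def)
  \<comment> \<open>The three entries serve the gaps at the time ends, the positivity of
    \<open>v\<close> in the tube, and the bound \<open>4 * L * m \<le> \<kappa> / 2\<close>.\<close>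
  define m where "m = min (\<delta> / 8) (min (w s2 / 2) (\<kappa> / (8 * (L + 1))))"
  have m: "m > 0" "m \<le> \<delta> / 8" "m < w s2" "m \<le> \<kappa> / (8 * (L + 1))"
  proof -
    have "\<kappa> / (8 * (L + 1)) > 0" using \<open>\<kappa> > 0\<close> L_nonneg by simp
    then show "m > 0" using \<open>\<delta> > 0\<close> \<open>w s2 > 0\<close> unfolding m_def by simp
    show "m \<le> \<delta> / 8" "m \<le> \<kappa> / (8 * (L + 1))" unfolding m_def by linarith+
    have "m \<le> w s2 / 2" unfolding m_def by linarith
    then show "m < w s2" using \<open>w s2 > 0\<close> by linarith
  qed
  have Lm: "4 * L * m \<le> \<kappa> / 2"
  proof -
    have "4 * L * m \<le> 4 * (L + 1) * (\<kappa> / (8 * (L + 1)))"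
      using m L_nonneg by (intro mult_mono) auto
    also have "\<dots> = \<kappa> / 2" using L_nonneg by (simp add: field_simps)
    finally show ?thesis .
  qed
  obtain d2 where "d2 > 0" and d2: "\<And>s x. \<lbrakk>s \<in> {a..c}; norm (x - y s) \<le> d2\<rbrakk> \<Longrightarrow> \<bar>v s x - v s (y s)\<bar> \<le> m"
    by (rule tube_modulus[OF _ _ v_cont y_cont' m(1)]) (use ac that in auto)
  \<comment> \<open>The tube is centred at \<open>Y\<close>, whose distance from \<open>y\<close>
    will be at most \<open>\<sigma>\<close>; radius \<open>d2 / 2\<close> keeps it in the tube of
    radius \<open>d2\<close> around \<open>y\<close>.\<close>
  define \<sigma> where "\<sigma> = d2 / 2"
  have "\<sigma> > 0" using \<open>d2 > 0\<close> by (simp add: \<sigma>_def)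
  \<comment> \<open>Chosen so that the averaging error \<open>8 * m * \<eta> / \<sigma>\<close> is
    exactly \<open>\<kappa> / 4\<close>.\<close>
  define \<eta> where "\<eta> = \<kappa> * \<sigma> / (32 * m)"
  have "\<eta> > 0" using \<open>\<kappa> > 0\<close> \<open>\<sigma> > 0\<close> m(1) by (simp add: \<eta>_def)
  have m\<eta>: "8 * m * \<eta> / \<sigma> = \<kappa> / 4" using \<open>\<sigma> > 0\<close> m(1) by (simp add: \<eta>_def)
  have "compact (y ` {t..T})" by (intro compact_continuous_image y_cont compact_Icc)
  then obtain R where R: "\<forall>s\<in>{t..T}. norm (y s) \<le> R"
    using compact_imp_bounded[of "y ` {t..T}"] by (auto simp: bounded_iff)
  obtain d3 where "d3 > 0" and d3: "\<And>r s x z u. \<lbrakk>r \<in> {0..T}; s \<in> {0..T}; norm x \<le> R + 1; norm z \<le> R + 1; u \<in> U;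
      \<bar>r - s\<bar> \<le> d3; norm (x - z) \<le> d3\<rbrakk> \<Longrightarrow> norm (f r x u - f s z u) \<le> \<eta>"
    by (rule f_modulus[OF \<open>\<eta> > 0\<close>, of "R + 1"]) (rule that)
  define \<omega> where "\<omega> = min \<sigma> (min d3 1)"
  have "\<omega> > 0" using \<open>\<sigma> > 0\<close> \<open>d3 > 0\<close> by (simp add: \<omega>_def)
  \<comment> \<open>The entries keep the window inside \<open>{t..T}\<close>, its length below the
    time modulus \<open>d3\<close>, and \<open>B * h\<close>, the distance between \<open>y\<close>
    and \<open>Y\<close>, below \<open>\<sigma>\<close>, \<open>d3\<close> and 1. The last keeps
    \<open>Y\<close> in the ball of radius \<open>R + 1\<close>.\<close>
  define h where "h = min (T - c) (min d3 (\<omega> / B))"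
  have h: "h > 0" "c + h \<le> T" "h \<le> d3" using ac(4) \<open>d3 > 0\<close> \<open>\<omega> > 0\<close> B(1) by (auto simp: h_def)
  have "B * h \<le> B * (\<omega> / B)" using B(1) by (intro mult_left_mono) (auto simp: h_def)
  then have Bh: "B * h \<le> \<sigma>" "B * h \<le> d3" "B * h \<le> 1" using B(1) by (auto simp: \<omega>_def)
  obtain Y Y' where Y: "\<And>s. s \<in> {0<..<T} \<Longrightarrow> (Y has_vector_derivative Y' s) (at s)"
    "continuous_on {0<..<T} Y'"
    and Y': "\<And>s. \<lbrakk>t \<le> s; s + h \<le> T\<rbrakk> \<Longrightarrow> Y' s = (y (s + h) - y s) /\<^sub>R h"
    and Y_near: "\<And>s r. \<lbrakk>t \<le> s; s + h \<le> T; r \<in> {s..s + h}\<rbrakk> \<Longrightarrow> norm (Y s - y r) \<le> B * h"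
    by (rule forward_average[OF B t _ h(1)]) (use ac that in auto)
  have "\<exists>s\<in>{a<..<c}. - \<psi>' s \<le> 4 * L * m + 8 * m * \<eta> / \<sigma>"
  proof (rule subsolution_along_curve[OF ac(2,4) sub v_cont Y \<psi>_deriv \<psi>'_cont \<open>\<sigma> > 0\<close> m(1) _ s1(1)])
    show "\<bar>v s x - w s\<bar> \<le> m \<and> v s x > 0" if s: "s \<in> {a..c}" and x: "norm (x - Y s) \<le> \<sigma>" for s x
    proof -
      have "norm (x - y s) \<le> norm (x - Y s) + norm (Y s - y s)"
        using norm_triangle_ineq[of "x - Y s" "Y s - y s"] by simp
      also have "\<dots> \<le> d2" using x Y_near[of s s] s ac h Bh(1) by (simp add: \<sigma>_def)
      finally have "\<bar>v s x - w s\<bar> \<le> m" using d2[OF s] by (simp add: w_def)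
      then show ?thesis using s2(2)[OF s] m(3) by linarith
    qed
    have "\<psi> a = 2 * \<delta>" by (simp add: \<psi>_def)
    then show "w a - \<psi> a + 2 * m < w s1 - \<psi> s1" using w_s1 \<psi>_s1 m(2) \<open>\<delta> > 0\<close> by linarith
    have "w a = w c + 3 * \<delta>" by (simp add: \<delta>_def field_simps)
    then show "w c - \<psi> c + 2 * m < w s1 - \<psi> s1" using w_s1 \<psi>_s1 m(2) \<open>\<delta> > 0\<close> \<psi>_pos[of c] by linarith
    show "- (q \<bullet> Y' s) \<le> hamiltonian f U s (Y s) q + norm q * \<eta>" if s: "s \<in> {a<..<c}" for s q
    proof -
      have s': "t \<le> s" "s + h \<le> T" using s ac h by auto
      have "- (q \<bullet> (y (s + h) - y s)) \<le> (hamiltonian f U s (Y s) q + norm q * \<eta>) * h"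
      proof (rule solution_increment_le_hamiltonian[OF u t y s'(1) h(1) s'(2)])
        fix r u assume r: "r \<in> {s..s + h}" and "u \<in> U"
        have near: "norm (y r - Y s) \<le> B * h" using Y_near[OF s' r] by (simp add: norm_minus_commute)
        have "norm (y r) \<le> R" using R r s' by simp
        moreover have "norm (Y s) \<le> norm (y r - Y s) + norm (y r)"
          using norm_triangle_ineq4[of "y r" "y r - Y s"] by simp
        ultimately have "norm (y r) \<le> R + 1" "norm (Y s) \<le> R + 1" using near Bh(3) by linarith+
        then show "norm (f r (y r) u - f s (Y s) u) \<le> \<eta>"
          using r s' t h near Bh(2) \<open>u \<in> U\<close> by (intro d3) auto
      qed
      also have "- (q \<bullet> (y (s + h) - y s)) = - (q \<bullet> Y' s) * h" using h(1) by (simp add: Y'[OF s'])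
      finally show ?thesis using h(1) by (rule mult_right_le_imp_le)
    qed
    show "0 \<le> \<eta>" using \<open>\<eta> > 0\<close> by (rule less_imp_le)
  qed
  then obtain s where s: "s \<in> {a<..<c}" "- \<psi>' s \<le> 4 * L * m + 8 * m * \<eta> / \<sigma>" by blast
  have "- \<psi>' s \<le> \<kappa> / 2 + \<kappa> / 4" using s(2) Lm unfolding m\<eta> by linarith
  then show False using \<psi>'_le[OF s(1)] \<open>\<kappa> > 0\<close> by linarith
qed

lemma subsolution_nonpos_along_solution:
  fixes v :: "real \<Rightarrow> 'n \<Rightarrow> real"
  assumes u: "u \<in> controls t T U" and t: "0 \<le> t" "t \<le> T" and y: "is_solution f t T x u y"
    and sub: "visc_subsolution f U {(t, x). t \<in> {0<..<T} \<and> v t x > 0} v"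
    and v_cont: "continuous_on ({0..T} \<times> UNIV) (\<lambda>(t, x). v t x)"
    and end_le: "v T (y T) \<le> 0"
  shows "v t x \<le> 0"
proof (rule ccontr)
  assume "\<not> v t x \<le> 0"
  define w where "w s = v s (y s)" for s
  have "w t > 0" using \<open>\<not> _\<close> y by (simp add: w_def is_solution_def)
  have "continuous_on {t..T} y"
    using y abs_continuous_on_imp_continuous_on by (auto simp: is_solution_def)
  then have "continuous_on {t..T} (\<lambda>s. (\<lambda>(t, x). v t x) (s, y s))"
    using t by (intro continuous_on_compose2[OF v_cont] continuous_intros) auto
  then have w_cont: "continuous_on {t..T} w" by (simp add: w_def[abs_def])
  define K where "K = {s \<in> {t..T}. w s \<in> {..0}}"
  have "K = {t..T} \<inter> w -` {..0}" by (auto simp: K_def)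
  then have "closed K" using continuous_closed_preimage[OF w_cont closed_atLeastAtMost closed_atMost] by simp
  moreover have "T \<in> K" using t end_le by (simp add: K_def w_def)
  moreover have K_bdd: "bdd_below K" by (auto simp: K_def)
  ultimately have "Inf K \<in> K" using closed_contains_Inf by blast
  define b where "b = Inf K"
  have b: "b \<in> {t..T}" "w b \<le> 0" using \<open>Inf K \<in> K\<close> by (auto simp: K_def b_def)
  then have "t < b" using \<open>w t > 0\<close> by (cases "t = b") auto
  have before: "w s > 0" if "s \<in> {t..<b}" for s
    using that b cInf_lower[OF _ K_bdd, of s] by (force simp: K_def b_def)
  \<comment> \<open>All inequalities towards the ends are strict because \<open>t\<close> may be 0
    and \<open>b\<close> may be \<open>T\<close>, where the subsolution property says nothing. The
    value at \<open>b\<close> is reached by a limit from the left.\<close>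
  have mono: "w a \<le> w c" if "t < a" "a \<le> c" "c < b" for a c
    unfolding w_def
    by (rule subsolution_nondecreasing[OF u t(1) y _ _ _ _ sub v_cont])
      (use that t b before in \<open>auto simp: w_def[symmetric]\<close>)
  define a where "a = (t + b) / 2"
  have a: "t < a" "a < b" using \<open>t < b\<close> by (auto simp: a_def)
  have "w a \<le> w b"
  proof (rule tendsto_lowerbound)
    have "(w \<longlongrightarrow> w b) (at b within {t..T})" using w_cont b(1) by (simp add: continuous_on_def)
    then show "(w \<longlongrightarrow> w b) (at b within {a..<b})"
      by (rule tendsto_within_subset) (use a b in auto)
    show "\<forall>\<^sub>F s in at b within {a..<b}. w a \<le> w s"
      using mono a by (auto simp: eventually_at_filter)
    have "b islimpt {a..<b}"
      using islimpt_greaterThanLessThan2[OF a(2)] by (rule islimpt_subset) auto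
    then show "at b within {a..<b} \<noteq> bot" by (simp add: trivial_limit_within)
  qed
  then show False using before[of a] a b(2) by auto
qed

end

theorem theorem4:
  fixes T :: real
    and U :: "(real^'m) set"
    and f :: "real \<Rightarrow> real^'n \<Rightarrow> real^'m \<Rightarrow> real^'n"
    and g gl :: "real^'n \<Rightarrow> real"
    and vl :: "real \<Rightarrow> real^'n \<Rightarrow> real"
  assumes T_pos: "T > 0"
    and U_compact: "compact U" and U_ne: "U \<noteq> {}"
    and f_cont: "continuous_on ({0..T} \<times> UNIV \<times> U) (\<lambda>(s, x, u). f s x u)"
    and f_lip: "\<exists>L. \<forall>s\<in>{0..T}. \<forall>u\<in>U. \<forall>x y. norm (f s x u - f s y u) \<le> L * norm (x - y)"
    and g_cont: "continuous_on UNIV g"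
    and vl_cont: "continuous_on ({0..T} \<times> UNIV) (\<lambda>(t, x). vl t x)"
    and vl_sub: "visc_subsolution f U {(t, x). t \<in> {0<..<T} \<and> vl t x > 0} vl"
    and vl_T: "\<forall>x. vl T x = gl x"
    and gl_X: "\<forall>x\<in>{x. g x \<le> 0}. gl x \<le> 0"
  shows "\<forall>t\<in>{0..T}. reach_set f U T {x. g x \<le> 0} t \<subseteq> {x. vl t x \<le> 0}"
proof (intro ballI subsetI)
  fix t x assume t: "t \<in> {0..T}" and x: "x \<in> reach_set f U T {x. g x \<le> 0} t"
  obtain L where L: "\<forall>s\<in>{0..T}. \<forall>u\<in>U. \<forall>x y. norm (f s x u - f s y u) \<le> L * norm (x - y)"
    using f_lip by blast
  \<comment> \<open>Passing to the absolute value keeps the Lipschitz estimate and supplies the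
    nonnegative constant that the locale requires.\<close>
  interpret control_system f U T "\<bar>L\<bar>"
  proof
    show "norm (f s x u - f s y u) \<le> \<bar>L\<bar> * norm (x - y)" if "s \<in> {0..T}" "u \<in> U" for s x y u
      using L that by (meson abs_ge_self mult_right_mono norm_ge_zero order_trans)
  qed (use U_compact U_ne f_cont in auto)
  obtain u where u: "u \<in> controls t T U" and "g (traj f T t x u T) \<le> 0"
    using x by (auto simp: reach_set_def)
  moreover obtain y where y: "is_solution f t T x u y" "traj f T t x u T = y T"
    using traj_obtain_solution[OF u] t by auto
  ultimately have "vl T (y T) \<le> 0" using vl_T gl_X by simp
  then show "x \<in> {x. vl t x \<le> 0}"
    using subsolution_nonpos_along_solution[OF u _ _ y(1) vl_sub vl_cont] t by simp
qed

end
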